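(* Let $\mathbb G$ be a (prototype) Heisenberg-type group, $0<\alpha<1$, and let $f:\Pi\to\mathbb R$ be a bounded function on $\Pi=\Pi_0=\{x_1=0\}\subset\mathbb G$. Then $f\in C^{2,\alpha}(\Pi)$ if and only if $f\in\Gamma^{2,\alpha}(\Pi)$, namely if and only if there is $C>0$ such that for each $\hat\xi\in\Pi$ there is a polynomial $$P_{\hat\xi}(\hat\eta)=a_{\hat\xi}+b_{\hat\xi}\cdot\hat v+\hat v^TC_{\hat\xi}\hat v+d_{\hat\xi}\cdot z,\qquad (0,\hat v,z)=\mathrm{Log}_{(0,\hat\eta)}((0,\hat\xi)),$$ with $a_{\hat\xi}\in\mathbb R$, $b_{\hat\xi}\in\mathbb R^{m-1}$, $C_{\hat\xi}$ a symmetric $(m-1)\times(m-1)$ real matrix and $d_{\hat\xi}\in\mathbb R^n$, such that for every $\rho>0$ and every $\hat\eta\in B_\rho(\hat\xi)$, $$|f(\hat\eta)-P_{\hat\xi}(\hat\eta)|<C\rho^{2+\alpha}.$$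
   Context: Prototype $H$-type group: for integers $m\ge2$, $n\ge1$, let $A^{(k)}=(a^k_{i,j})_{i,j=1}^m$, $k=1,\dots,n$, be skew-symmetric orthogonal matrices with $A^{(k)}A^{(\ell)}+A^{(\ell)}A^{(k)}=0$ for $k\ne\ell$. $\mathbb G$ is $\mathbb R^{m+n}$, with points $\xi=(x,t)$, and group law $(x,t)\circ(y,\tau)=(x+y,\ (t_k+\tau_k+\tfrac12\langle A^{(k)}x,y\rangle)_{k=1}^n)$; $|(x,t)|_{\mathbb G}=(|x|^4+16|t|^2)^{1/4}$; $\mathrm{Log}_\eta(\xi)=\eta^{-1}\circ\xi$. Points of $\Pi=\{x_1=0\}$ are written $\hat\xi=(\hat x,t)$, $\hat x=(x_2,\dots,x_m)$, and identified with $(0,\hat\xi)=(0,\hat x,t)\in\mathbb G$. The distance on $\Pi$ is $\tilde d(\hat\xi,\hat\eta)=|(0,\hat\eta)^{-1}\circ(0,\hat\xi)|_{\mathbb G}$ and $B_\rho(\hat\xi)=\{\hat\eta\in\Pi:\tilde d(\hat\xi,\hat\eta)<\rho\}$. For $j=2,\dots,m$ put $\hat X_j=X_j|_{x_1=0}=\partial_{x_j}+\tfrac12\sum_{k=1}^n\big(\sum_{i=2}^ma^k_{j,i}x_i\big)\partial_{t_k}$, and $Z_k=\partial_{t_k}$, $k=1,\dots,n$. The horizontal tangential Hessian is $\hat X^2f(\hat\xi)_{i,j}=\tfrac12(\hat X_i\hat X_jf(\hat\xi)+\hat X_j\hat X_if(\hat\xi))$, $i,j=2,\dots,m$. A function $f$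 on $\Pi$ belongs to $C^{2,\alpha}(\Pi)$ if $\hat X_i\hat X_jf$ ($i,j=2,\dots,m$) and $Z_kf$ ($k=1,\dots,n$) exist and are continuous and there is $C>0$ with $|\hat X^2f(\hat\eta)_{i,j}-\hat X^2f(\hat\xi)_{i,j}|\le C\tilde d(\hat\eta,\hat\xi)^\alpha$ and $|Z_kf(\hat\eta)-Z_kf(\hat\xi)|\le C\tilde d(\hat\xi,\hat\eta)^\alpha$ for all $i,j,k$ and all $\hat\xi,\hat\eta\in\Pi$. *)

theory Defs
  imports "HOL-Analysis.Analysis"
begin

text \<open>
  The coordinate indices \<open>1, \<dots>, m\<close> are the elements of \<open>'h option\<close>: \<open>None\<close> is the index \<open>1\<close> and
  \<open>Some j\<close>, for \<open>j :: 'h\<close>, are the indices \<open>2, \<dots>, m\<close>. So \<open>m = CARD('h) + 1\<close> is an arbitrary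
  integer \<open>\<ge> 2\<close>, and \<open>n = CARD('n)\<close> is an arbitrary integer \<open>\<ge> 1\<close>.
  The space \<open>\<real>\<^bsup>m+n\<^esup>\<close> underlying the group is \<open>('h, 'n) gpoint\<close>, and the hyperplane \<open>x\<^sub>1 = 0\<close>
  is the type \<open>('h, 'n) hpoint\<close>, identified with a subset of the group by \<open>embed\<close> below.
\<close>

type_synonym ('h, 'n) gpoint = "(real ^ 'h option) \<times> (real ^ 'n)"
type_synonym ('h, 'n) hpoint = "(real ^ 'h) \<times> (real ^ 'n)"
type_synonym ('h, 'n) structure_mats = "'n \<Rightarrow> real ^ 'h option ^ 'h option"

definition htype_matrices :: "('h::finite, 'n::finite) structure_mats \<Rightarrow> bool" where
  "htype_matrices A \<longleftrightarrow>
     (\<forall>k. transpose (A k) = - A k) \<and>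
     (\<forall>k. orthogonal_matrix (A k)) \<and>
     (\<forall>k l. k \<noteq> l \<longrightarrow> A k ** A l + A l ** A k = 0)"

definition gmult ::
  "('h::finite, 'n::finite) structure_mats \<Rightarrow> ('h, 'n) gpoint \<Rightarrow> ('h, 'n) gpoint \<Rightarrow> ('h, 'n) gpoint" where
  "gmult A \<xi> \<eta> =
     (fst \<xi> + fst \<eta>,
      \<chi> k. snd \<xi> $ k + snd \<eta> $ k + 1 / 2 * ((A k *v fst \<xi>) \<bullet> fst \<eta>))"

text \<open>
  The group inverse; the lemmas \<open>gmult_ginv_left\<close> and \<open>gmult_ginv_right\<close> below justify it,
  the identity being \<open>0\<close>.
\<close>

definition ginv :: "('h::finite, 'n::finite) gpoint \<Rightarrow> ('h, 'n) gpoint" where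
  "ginv \<xi> = - \<xi>"

definition gnorm :: "('h::finite, 'n::finite) gpoint \<Rightarrow> real" where
  "gnorm \<xi> = root 4 (norm (fst \<xi>) ^ 4 + 16 * norm (snd \<xi>) ^ 2)"

definition gLog ::
  "('h::finite, 'n::finite) structure_mats \<Rightarrow> ('h, 'n) gpoint \<Rightarrow> ('h, 'n) gpoint \<Rightarrow> ('h, 'n) gpoint" where
  "gLog A \<eta> \<xi> = gmult A (ginv \<eta>) \<xi>"

definition embed :: "('h::finite, 'n::finite) hpoint \<Rightarrow> ('h, 'n) gpoint" where
  "embed \<xi> = (\<chi> i. case i of None \<Rightarrow> 0 | Some j \<Rightarrow> fst \<xi> $ j, snd \<xi>)"

definition hat :: "('h::finite, 'n::finite) gpoint \<Rightarrow> ('h, 'n) hpoint" where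
  "hat \<xi> = (\<chi> j. fst \<xi> $ Some j, snd \<xi>)"

definition hdist ::
  "('h::finite, 'n::finite) structure_mats \<Rightarrow> ('h, 'n) hpoint \<Rightarrow> ('h, 'n) hpoint \<Rightarrow> real" where
  "hdist A \<xi> \<eta> = gnorm (gmult A (ginv (embed \<eta>)) (embed \<xi>))"

definition hball ::
  "('h::finite, 'n::finite) structure_mats \<Rightarrow> real \<Rightarrow> ('h, 'n) hpoint \<Rightarrow> ('h, 'n) hpoint set" where
  "hball A \<rho> \<xi> = {\<eta>. hdist A \<xi> \<eta> < \<rho>}"

text \<open>
  A vector field \<open>V\<close> acts on functions as a single derivative in the direction \<open>V \<xi>\<close>; the partial
  derivatives occurring in the coordinate expression of \<open>V\<close> need not exist separately.
  For the fields \<open>hX\<close> and \<open>hZ\<close> below, the line \<open>s \<mapsto> \<xi> + s V(\<xi>)\<close> is the integral curve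
  of \<open>V\<close> through \<open>\<xi>\<close> (see \<open>hX_along_line\<close>).
\<close>

definition Lie_differentiable :: "('a::real_normed_vector \<Rightarrow> 'a) \<Rightarrow> ('a \<Rightarrow> real) \<Rightarrow> 'a \<Rightarrow> bool" where
  "Lie_differentiable V f \<xi> \<longleftrightarrow> (\<lambda>s::real. f (\<xi> + s *\<^sub>R V \<xi>)) field_differentiable (at 0)"

definition Lie_deriv :: "('a::real_normed_vector \<Rightarrow> 'a) \<Rightarrow> ('a \<Rightarrow> real) \<Rightarrow> 'a \<Rightarrow> real" where
  "Lie_deriv V f \<xi> = deriv (\<lambda>s::real. f (\<xi> + s *\<^sub>R V \<xi>)) 0"

definition hX ::
  "('h::finite, 'n::finite) structure_mats \<Rightarrow> 'h \<Rightarrow> ('h, 'n) hpoint \<Rightarrow> ('h, 'n) hpoint" where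
  "hX A j \<xi> = (axis j 1, \<chi> k. 1 / 2 * (\<Sum>i\<in>UNIV. A k $ Some j $ Some i * fst \<xi> $ i))"

definition hZ :: "'n \<Rightarrow> ('h::finite, 'n::finite) hpoint \<Rightarrow> ('h, 'n) hpoint" where
  "hZ k \<xi> = (0, axis k 1)"

definition hHessian ::
  "('h::finite, 'n::finite) structure_mats \<Rightarrow> (('h, 'n) hpoint \<Rightarrow> real) \<Rightarrow> ('h, 'n) hpoint \<Rightarrow> real ^ 'h ^ 'h" where
  "hHessian A f \<xi> =
     (\<chi> i j. 1 / 2 * (Lie_deriv (hX A i) (Lie_deriv (hX A j) f) \<xi> +
                     Lie_deriv (hX A j) (Lie_deriv (hX A i) f) \<xi>))"

definition C2_alpha ::
  "('h::finite, 'n::finite) structure_mats \<Rightarrow> real \<Rightarrow> (('h, 'n) hpoint \<Rightarrow> real) \<Rightarrow> bool" where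
  "C2_alpha A \<alpha> f \<longleftrightarrow>
     (\<forall>j \<xi>. Lie_differentiable (hX A j) f \<xi>) \<and>
     (\<forall>i j \<xi>. Lie_differentiable (hX A i) (Lie_deriv (hX A j) f) \<xi>) \<and>
     (\<forall>i j. continuous_on UNIV (Lie_deriv (hX A i) (Lie_deriv (hX A j) f))) \<and>
     (\<forall>k \<xi>. Lie_differentiable (hZ k) f \<xi>) \<and>
     (\<forall>k. continuous_on UNIV (Lie_deriv (hZ k) f)) \<and>
     (\<exists>C>0.
        (\<forall>i j \<xi> \<eta>. \<bar>hHessian A f \<eta> $ i $ j - hHessian A f \<xi> $ i $ j\<bar> \<le> C * hdist A \<eta> \<xi> powr \<alpha>) \<and>
        (\<forall>k \<xi> \<eta>. \<bar>Lie_deriv (hZ k) f \<eta> - Lie_deriv (hZ k) f \<xi>\<bar> \<le> C * hdist A \<xi> \<eta> powr \<alpha>))"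

definition hpoly ::
  "('h::finite, 'n::finite) structure_mats \<Rightarrow> ('h, 'n) hpoint \<Rightarrow>
     real \<Rightarrow> real ^ 'h \<Rightarrow> real ^ 'h ^ 'h \<Rightarrow> real ^ 'n \<Rightarrow> ('h, 'n) hpoint \<Rightarrow> real" where
  "hpoly A \<xi> a b M d \<eta> =
     (let (v, z) = hat (gLog A (embed \<eta>) (embed \<xi>))
      in a + b \<bullet> v + v \<bullet> (M *v v) + d \<bullet> z)"

definition Gamma2_alpha ::
  "('h::finite, 'n::finite) structure_mats \<Rightarrow> real \<Rightarrow> (('h, 'n) hpoint \<Rightarrow> real) \<Rightarrow> bool" where
  "Gamma2_alpha A \<alpha> f \<longleftrightarrow>
     (\<exists>C>0. \<forall>\<xi>. \<exists>a b M d. transpose M = M \<and>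
        (\<forall>\<rho>>0. \<forall>\<eta>\<in>hball A \<rho> \<xi>. \<bar>f \<eta> - hpoly A \<xi> a b M d \<eta>\<bar> < C * \<rho> powr (2 + \<alpha>)))"


lemma htype_skew_entry:
  assumes "htype_matrices A"
  shows "A k $ i $ j = - A k $ j $ i"
proof -
  have "transpose (A k) $ j $ i = (- A k) $ j $ i"
    using assms unfolding htype_matrices_def by simp
  then show ?thesis by (simp add: transpose_def)
qed

lemma htype_skew_inner:
  assumes "htype_matrices A"
  shows "(A k *v x) \<bullet> x = 0"
proof -
  have "(A k *v x) \<bullet> x = (transpose (A k) *v x) \<bullet> x"
    by (metis dot_lmul_matrix inner_commute transpose_matrix_vector)
  also have "\<dots> = - ((A k *v x) \<bullet> x)"
    using assms unfolding htype_matrices_def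
    by (simp add: matrix_vector_mult_def inner_vec_def sum_negf)
  finally show ?thesis by simp
qed

lemma gmult_ginv_left: "htype_matrices A \<Longrightarrow> gmult A (ginv \<xi>) \<xi> = 0"
  using htype_skew_inner[of A]
  by (simp add: gmult_def ginv_def prod_eq_iff vec_eq_iff matrix_vector_mult_def
      inner_vec_def sum_negf)

lemma gmult_ginv_right: "htype_matrices A \<Longrightarrow> gmult A \<xi> (ginv \<xi>) = 0"
  by (simp add: gmult_def ginv_def htype_skew_inner prod_eq_iff vec_eq_iff)

lemma hat_embed: "hat (embed \<xi>) = \<xi>"
  by (simp add: hat_def embed_def)

text \<open>The logarithm of two points of the hyperplane has vanishing first coordinate.\<close>

lemma embed_hat_gLog: "embed (hat (gLog A (embed \<eta>) (embed \<xi>))) = gLog A (embed \<eta>) (embed \<xi>)"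
  by (auto simp: embed_def hat_def gLog_def gmult_def ginv_def prod_eq_iff vec_eq_iff
      split: option.split)

lemma hX_along_line:
  assumes "htype_matrices A"
  shows "hX A j (\<xi> + s *\<^sub>R hX A j \<xi>) = hX A j \<xi>"
proof -
  have "A k $ Some j $ Some j = 0" for k
    using htype_skew_entry[OF assms, of k "Some j" "Some j"] by simp
  then have "A k $ Some j $ Some i * (s * axis j (1::real) $ i) = 0" for k i
    by (cases "i = j") (simp_all add: axis_def)
  then have "A k $ Some j $ Some i * (fst \<xi> $ i + s * axis j (1::real) $ i) =
      A k $ Some j $ Some i * fst \<xi> $ i" for k i
    by (simp only: distrib_left add_0_right)
  then show ?thesis
    by (simp only: hX_def fst_add fst_scaleR fst_conv vector_add_component
        vector_scaleR_component real_scaleR_def)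
qed

end

theory Submission
  imports Defs
begin

text \<open>
  The hyperplane is closed under the group law, and on it the law reads
  \<open>(x, t) \<odot> (y, \<tau>) = (x + y, t + \<tau> + \<omega> x y)\<close> with the alternating bilinear form \<open>\<omega>\<close> that the matrices
  induce on the last \<open>m - 1\<close> coordinates. The fields \<open>hX j\<close> and \<open>hZ k\<close> are the left invariant ones:
  their integral curves through \<open>\<xi>\<close> are \<open>s \<mapsto> \<xi> \<odot> s v\<close> with \<open>v\<close> a horizontal or a vertical basis
  vector. The distance from \<open>\<xi>\<close> to \<open>\<xi> \<odot> p\<close> is the gauge of \<open>p\<close>, and the coordinates in which the
  approximating polynomials are written are those of \<open>-p\<close>. So both sides of the equivalence speak
  of the function \<open>p \<mapsto> f (\<xi> \<odot> p)\<close> near \<open>0\<close>, uniformly in \<open>\<xi>\<close>. The form \<open>\<omega>\<close> may vanish (it does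
  for \<open>m = 2\<close>), so the derivatives \<open>Z\<^sub>k f\<close> are not available as commutators and have to be carried
  along as independent data.

  From \<open>C\<^bsup>2,\<alpha>\<^esup>\<close> to \<open>\<Gamma>\<^bsup>2,\<alpha>\<^esup>\<close> the polynomial is the Taylor polynomial, and the remainder is estimated
  along the straight horizontal segment from \<open>\<xi>\<close> to \<open>\<xi> \<odot> (y, 0)\<close> followed by a vertical one. On the
  segment the second derivative of \<open>f\<close> is \<open>y\<^sup>T H y\<close>, where only the symmetrised Hessian \<open>H\<close> counts, which
  is exactly the matrix that is assumed to be Hoelder continuous. The difficulty is that only the
  derivatives along the basis fields are given, and that these fields do not commute: a path along
  the fields one after the other misses \<open>\<xi> \<odot> (s y, 0)\<close> by a vertical step of size \<open>s\<^sup>2\<close>.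
  Lemma \<open>lie_diff_horizontal\<close> shows that this error is harmless for a function that is Hoelder
  continuous in the vertical directions with an exponent above \<open>1/2\<close>. For \<open>f\<close> itself the exponent
  is \<open>1\<close>, because \<open>Z\<^sub>k f\<close> is bounded, being Hoelder continuous with \<open>f\<close> bounded. For \<open>X\<^sub>j f\<close> the exponent
  is \<open>(1 + \<alpha>) / 2\<close>, although \<open>Z\<^sub>k X\<^sub>j f\<close> need not exist: lemma \<open>g_vertical_holder\<close> obtains it by
  interpolation, expressing \<open>X\<^sub>j f\<close> by difference quotients of \<open>f\<close> of step \<open>\<surd>\<bar>\<tau>\<bar>\<close>.

  From \<open>\<Gamma>\<^bsup>2,\<alpha>\<^esup>\<close> to \<open>C\<^bsup>2,\<alpha>\<^esup>\<close> the polynomials at \<open>\<xi>\<close> and at \<open>\<xi> \<odot> p\<close> are compared. Both approximate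
  \<open>f\<close> within \<open>O(r\<^bsup>2+\<alpha>\<^esup>)\<close> on a ball of radius comparable to \<open>r = koranyi p\<close>, so they differ there by
  \<open>O(r\<^bsup>2+\<alpha>\<^esup>)\<close>. Testing with increments of size \<open>r\<close> separates the coefficients (lemma
  \<open>coefficients_holder\<close>): those of degree two are Hoelder continuous of exponent \<open>\<alpha>\<close>, and the linear
  one has a first order expansion with remainder \<open>O(r\<^bsup>1+\<alpha>\<^esup>)\<close>. The latter says that
  \<open>X\<^sub>i X\<^sub>j f = 2 M\<^sub>i\<^sub>j + d \<bullet> \<omega> e\<^sub>i e\<^sub>j\<close>, whose symmetric part is \<open>2 M\<close>.
\<close>

section \<open>Step two groups and their homogeneous gauge\<close>

locale step_two_group =
  fixes \<omega> :: "real ^ 'h::finite \<Rightarrow> real ^ 'h \<Rightarrow> real ^ 'n::finite"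
  assumes bilinear: "bounded_bilinear \<omega>"
    and alternating: "\<omega> x x = 0"
begin

sublocale form: bounded_bilinear \<omega> by (rule bilinear)

lemma skew: "\<omega> x y = - \<omega> y x"
proof -
  have "\<omega> x y + \<omega> y x = \<omega> (x + y) (x + y) - \<omega> x x - \<omega> y y"
    unfolding form.add_left form.add_right by simp
  then have "\<omega> x y + \<omega> y x = 0"
    by (simp add: alternating)
  then show ?thesis by (simp only: eq_neg_iff_add_eq_0)
qed

definition mul :: "('h, 'n) hpoint \<Rightarrow> ('h, 'n) hpoint \<Rightarrow> ('h, 'n) hpoint" (infixl "\<odot>" 70) where
  "p \<odot> q = (fst p + fst q, snd p + snd q + \<omega> (fst p) (fst q))"

lemma mul_assoc: "p \<odot> q \<odot> r = p \<odot> (q \<odot> r)"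
  by (simp add: mul_def form.add_left form.add_right)

lemma mul_0_right [simp]: "p \<odot> 0 = p"
  by (simp add: mul_def form.zero_right)

lemma mul_minus_cancel_left [simp]: "(- p) \<odot> (p \<odot> q) = q"
  by (simp add: mul_def form.add_right form.minus_left alternating)

lemma mul_minus_cancel_left' [simp]: "p \<odot> ((- p) \<odot> q) = q"
  using mul_minus_cancel_left[of "- p" q] by simp

lemma minus_mul_mul [simp]: "(- (p \<odot> q)) \<odot> p = - q"
  using skew[of "fst p" "fst q"]
  by (simp add: mul_def form.diff_left form.minus_left alternating prod_eq_iff)

lemma mul_one_parameter: "s *\<^sub>R v \<odot> r *\<^sub>R v = (s + r) *\<^sub>R v"
  by (simp add: mul_def form.scaleR_left form.scaleR_right alternating scaleR_add_left prod_eq_iff)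

text \<open>
  The two identities behind all telescoping: every step is a horizontal one followed by a vertical
  one, and joining two horizontal steps into one costs a vertical correction by the form.
\<close>

lemma mul_split: "\<xi> \<odot> (y, \<tau>) = \<xi> \<odot> (y, 0) \<odot> (0, \<tau>)"
  by (simp add: mul_def form.zero_right)

lemma mul_horizontal_add:
  "\<xi> \<odot> (x + y, 0) = \<xi> \<odot> (x, 0) \<odot> (y, 0) \<odot> (0, - \<omega> x y)"
  by (simp add: mul_def form.zero_right form.add_left form.add_right)

lemma tendsto_mul [tendsto_intros]:
  assumes "(p \<longlongrightarrow> a) F" and "(q \<longlongrightarrow> b) F"
  shows "((\<lambda>x. p x \<odot> q x) \<longlongrightarrow> a \<odot> b) F"
  unfolding mul_def by (intro tendsto_intros form.tendsto assms)

text \<open>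
  The homogeneous gauge of the group: it scales by \<open>s\<close> under the dilation \<open>(x, t) \<mapsto> (s x, s\<^sup>2 t)\<close>.
\<close>

definition koranyi :: "('h, 'n) hpoint \<Rightarrow> real" where
  "koranyi p = root 4 (norm (fst p) ^ 4 + 16 * norm (snd p) ^ 2)"

lemma koranyi_nonneg [simp]: "0 \<le> koranyi p"
  by (simp add: koranyi_def)

lemma koranyi_minus [simp]: "koranyi (- p) = koranyi p"
  by (simp add: koranyi_def)

lemma koranyi_horizontal [simp]: "koranyi (x, 0) = norm x"
  by (simp add: koranyi_def real_root_power_cancel)

lemma koranyi_mono:
  assumes "norm (fst p) \<le> norm (fst q)" and "norm (snd p) \<le> norm (snd q)"
  shows "koranyi p \<le> koranyi q"
  unfolding koranyi_def using assms
  by (intro real_root_le_mono add_mono mult_left_mono power_mono) auto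

lemma koranyi_vertical [simp]: "koranyi (0, t) = 2 * sqrt (norm t)"
proof -
  have "(2 * sqrt (norm t)) ^ 4 = 16 * ((sqrt (norm t))\<^sup>2)\<^sup>2"
    by (simp only: power_mult_distrib flip: power_mult) simp
  then have "16 * norm t ^ 2 = (2 * sqrt (norm t)) ^ 4"
    by simp
  then have "koranyi (0, t) = root 4 ((2 * sqrt (norm t)) ^ 4)"
    by (simp add: koranyi_def)
  also have "\<dots> = 2 * sqrt (norm t)"
    by (rule real_root_power_cancel) auto
  finally show ?thesis .
qed

lemma norm_fst_le_koranyi: "norm (fst p) \<le> koranyi p"
  using koranyi_mono[of "(fst p, 0)" p] by simp

lemma norm_snd_le_koranyi: "norm (snd p) \<le> (koranyi p)\<^sup>2"
proof -
  have "2 * sqrt (norm (snd p)) \<le> koranyi p"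
    using koranyi_mono[of "(0, snd p)" p] by simp
  then have "sqrt (norm (snd p)) \<le> koranyi p"
    using real_sqrt_ge_zero[OF norm_ge_zero[of "snd p"]] by linarith
  then show ?thesis
    using power_mono[of "sqrt (norm (snd p))" "koranyi p" 2] by simp
qed

text \<open>
  The form in which a quasi-triangle inequality is used: a bound on the gauge of a product follows
  from bounds on its two components, taken at the scales \<open>r\<close> and \<open>r\<^sup>2\<close>.
\<close>

lemma koranyi_le:
  assumes "norm (fst p) \<le> c * r" and "norm (snd p) \<le> (c * r)\<^sup>2" and "0 \<le> c" and "0 \<le> r"
  shows "koranyi p \<le> 3 * c * r"
proof -
  have "norm (fst p) ^ 4 \<le> (c * r) ^ 4"
    using assms by (intro power_mono) auto
  moreover have "norm (snd p) ^ 2 \<le> ((c * r)\<^sup>2) ^ 2"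
    using assms by (intro power_mono) auto
  ultimately have "norm (fst p) ^ 4 + 16 * norm (snd p) ^ 2 \<le> 17 * (c * r) ^ 4"
    by simp
  also have "\<dots> \<le> (3 * c * r) ^ 4"
    using assms by (simp add: power_mult_distrib mult_right_mono)
  finally have "koranyi p \<le> root 4 ((3 * c * r) ^ 4)"
    unfolding koranyi_def by (intro real_root_le_mono) auto
  then show ?thesis using assms by (simp add: real_root_power_cancel)
qed

lemma koranyi_eq_0_iff: "koranyi p = 0 \<longleftrightarrow> p = 0"
proof
  assume "koranyi p = 0"
  then show "p = 0"
    using norm_fst_le_koranyi[of p] norm_snd_le_koranyi[of p] by (simp add: prod_eq_iff)
qed (simp add: koranyi_def)

lemma koranyi_0 [simp]: "koranyi 0 = 0"
  by (simp add: koranyi_eq_0_iff)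

lemma tendsto_koranyi [tendsto_intros]:
  "(p \<longlongrightarrow> a) F \<Longrightarrow> ((\<lambda>x. koranyi (p x)) \<longlongrightarrow> koranyi a) F"
  unfolding koranyi_def by (intro tendsto_intros)

text \<open>
  The gauge of \<open>(-\<xi>) \<odot> \<eta>\<close> depends continuously on \<open>\<eta>\<close> in the Euclidean topology and vanishes at
  \<open>\<eta> = \<xi>\<close>.
\<close>

lemma continuous_on_if_koranyi_holder:
  assumes "\<And>\<xi> p. \<bar>u (\<xi> \<odot> p) - u \<xi>\<bar> \<le> C * koranyi p powr \<alpha>" and "0 < \<alpha>"
  shows "continuous_on UNIV u"
  unfolding continuous_on_def
proof
  fix \<xi> :: "('h, 'n) hpoint"
  have "((\<lambda>\<eta>. koranyi ((- \<xi>) \<odot> \<eta>)) \<longlongrightarrow> koranyi ((- \<xi>) \<odot> \<xi>)) (at \<xi>)"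
    by (intro tendsto_intros)
  moreover have "koranyi ((- \<xi>) \<odot> \<xi>) = 0"
    using mul_minus_cancel_left[of \<xi> 0] by (simp add: koranyi_eq_0_iff)
  ultimately have "((\<lambda>\<eta>. koranyi ((- \<xi>) \<odot> \<eta>)) \<longlongrightarrow> 0) (at \<xi>)"
    by simp
  then have "((\<lambda>\<eta>. koranyi ((- \<xi>) \<odot> \<eta>) powr \<alpha>) \<longlongrightarrow> 0 powr \<alpha>) (at \<xi>)"
    using assms(2) by (intro tendsto_powr') auto
  then have "((\<lambda>\<eta>. C * koranyi ((- \<xi>) \<odot> \<eta>) powr \<alpha>) \<longlongrightarrow> 0) (at \<xi>)"
    using tendsto_mult_right_zero by fastforce
  then have "((\<lambda>\<eta>. u \<eta> - u \<xi>) \<longlongrightarrow> 0) (at \<xi>)"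
  proof (rule Lim_null_comparison[rotated], intro always_eventually allI)
    show "norm (u \<eta> - u \<xi>) \<le> C * koranyi ((- \<xi>) \<odot> \<eta>) powr \<alpha>" for \<eta>
      using assms(1)[of \<xi> "(- \<xi>) \<odot> \<eta>"] by simp
  qed
  then show "(u \<longlongrightarrow> u \<xi>) (at \<xi> within UNIV)"
    by (simp add: LIM_zero_iff)
qed

text \<open>
  The derivative of \<open>u\<close> along the left invariant field with value \<open>v\<close> at the origin. Horizontal
  and vertical fields, and their linear combinations, are treated alike because
  \<open>s \<mapsto> s v\<close> is a one-parameter subgroup for every \<open>v\<close>. By the same fact a derivative at
  \<open>s = 0\<close> for every base point gives the derivative at every \<open>s\<close>.
\<close>

definition lie_diff ::
  "(('h, 'n) hpoint \<Rightarrow> real) \<Rightarrow> ('h, 'n) hpoint \<Rightarrow> (('h, 'n) hpoint \<Rightarrow> real) \<Rightarrow> bool" where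
  "lie_diff u v u' \<longleftrightarrow>
     (\<forall>\<xi>. ((\<lambda>s. u (\<xi> \<odot> s *\<^sub>R v)) has_real_derivative u' \<xi>) (at 0))"

lemma lie_diff_at:
  assumes "lie_diff u v u'"
  shows "((\<lambda>s. u (\<xi> \<odot> s *\<^sub>R v)) has_real_derivative u' (\<xi> \<odot> s *\<^sub>R v)) (at s)"
proof -
  have "((\<lambda>r. u (\<xi> \<odot> s *\<^sub>R v \<odot> r *\<^sub>R v)) has_real_derivative u' (\<xi> \<odot> s *\<^sub>R v)) (at 0)"
    using assms unfolding lie_diff_def by blast
  then have "((\<lambda>r. u (\<xi> \<odot> (r + s) *\<^sub>R v)) has_real_derivative u' (\<xi> \<odot> s *\<^sub>R v)) (at 0)"
    by (simp add: mul_assoc mul_one_parameter add.commute)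
  then show ?thesis
    using DERIV_shift[of "\<lambda>r. u (\<xi> \<odot> r *\<^sub>R v)" "u' (\<xi> \<odot> s *\<^sub>R v)" 0 s] by simp
qed

lemma lie_diff_scale:
  assumes "lie_diff u v u'"
  shows "lie_diff u (c *\<^sub>R v) (\<lambda>\<xi>. c * u' \<xi>)"
  unfolding lie_diff_def
proof
  fix \<xi>
  have "((\<lambda>s. u (\<xi> \<odot> s *\<^sub>R v)) has_real_derivative u' \<xi>) (at (0 * c))"
    using assms unfolding lie_diff_def mult_zero_left by blast
  from DERIV_chain2[OF this DERIV_cmult_right[OF DERIV_ident, of c]]
  show "((\<lambda>s. u (\<xi> \<odot> s *\<^sub>R c *\<^sub>R v)) has_real_derivative c * u' \<xi>) (at 0)"
    by (simp add: mult.commute)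
qed

lemma lie_mean_value:
  assumes "lie_diff u v u'"
  obtains \<theta> where "0 < \<theta>" "\<theta> < 1" "u (\<xi> \<odot> v) = u \<xi> + u' (\<xi> \<odot> \<theta> *\<^sub>R v)"
proof -
  have "\<exists>\<theta>>0. \<theta> < 1 \<and> u (\<xi> \<odot> 1 *\<^sub>R v) - u (\<xi> \<odot> 0 *\<^sub>R v) = (1 - 0) * u' (\<xi> \<odot> \<theta> *\<^sub>R v)"
    by (rule MVT2[of 0 1 "\<lambda>s. u (\<xi> \<odot> s *\<^sub>R v)"]) (auto intro: lie_diff_at[OF assms])
  then show thesis using that by (auto simp: algebra_simps)
qed

lemma lie_taylor:
  assumes "lie_diff u v u'" and "lie_diff u' v u''"
  obtains \<theta> where "0 < \<theta>" "\<theta> < 1"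
    "u (\<xi> \<odot> v) = u \<xi> + u' \<xi> + u'' (\<xi> \<odot> \<theta> *\<^sub>R v) / 2"
proof -
  let ?D = "\<lambda>(m::nat) s. (if m = 0 then u else if m = 1 then u' else u'') (\<xi> \<odot> s *\<^sub>R v)"
  have "\<exists>t>0. t < 1 \<and> u (\<xi> \<odot> 1 *\<^sub>R v) =
      (\<Sum>m<2. ?D m 0 / fact m * 1 ^ m) + ?D 2 t / fact 2 * 1 ^ 2"
  proof (rule Maclaurin)
    show "\<forall>m t. m < 2 \<and> 0 \<le> t \<and> t \<le> 1 \<longrightarrow> (?D m has_real_derivative ?D (Suc m) t) (at t)"
      using lie_diff_at[OF assms(1)] lie_diff_at[OF assms(2)]
      by (auto simp: less_2_cases_iff)
  qed auto
  then show thesis using that by (auto simp: numeral_2_eq_2)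
qed

end

section \<open>From coordinate directions to all directions\<close>

text \<open>
  Restriction of a vector to the coordinates in \<open>J\<close>, so that increments can be built up one
  coordinate at a time by induction on \<open>J\<close>.
\<close>

definition truncate :: "'i set \<Rightarrow> real ^ 'i \<Rightarrow> real ^ 'i::finite" where
  "truncate J y = (\<chi> i. if i \<in> J then y $ i else 0)"

lemma truncate_empty [simp]: "truncate {} y = 0"
  by (simp add: truncate_def vec_eq_iff)

lemma truncate_UNIV [simp]: "truncate UNIV y = y"
  by (simp add: truncate_def vec_eq_iff)

lemma truncate_insert:
  "j \<notin> J \<Longrightarrow> truncate (insert j J) y = truncate J y + y $ j *\<^sub>R axis j 1"
  by (auto simp: truncate_def vec_eq_iff axis_def)

lemma tendsto_truncate_0:
  assumes "(y \<longlongrightarrow> 0) F"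
  shows "((\<lambda>x. truncate J (y x)) \<longlongrightarrow> 0) F"
proof (rule vec_tendstoI)
  fix i
  show "((\<lambda>x. truncate J (y x) $ i) \<longlongrightarrow> 0 $ i) F"
    using tendsto_vec_nth[OF assms, of i] by (cases "i \<in> J") (simp_all add: truncate_def)
qed

context step_two_group
begin

text \<open>
  Any point near \<open>\<xi>\<close> is reached by small steps along the basis fields followed by one vertical
  step. Each new coordinate contributes its own step and a vertical correction
  \<open>\<omega> a b\<close>, which also tends to \<open>0\<close>.
\<close>

lemma continuous_on_if_frame_lipschitz:
  assumes hor: "\<And>\<xi> j s. \<bar>u (\<xi> \<odot> (s *\<^sub>R axis j 1, 0)) - u \<xi>\<bar> \<le> K * \<bar>s\<bar>"
    and ver: "\<And>\<xi> \<tau>. \<bar>u (\<xi> \<odot> (0, \<tau>)) - u \<xi>\<bar> \<le> L * norm \<tau>"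
  shows "continuous_on UNIV u"
  unfolding continuous_on_def
proof
  fix \<xi> :: "('h, 'n) hpoint"
  define y where "y \<eta> = fst ((- \<xi>) \<odot> \<eta>)" for \<eta>
  define \<tau> where "\<tau> \<eta> = snd ((- \<xi>) \<odot> \<eta>)" for \<eta>
  have lim: "((\<lambda>\<eta>. (- \<xi>) \<odot> \<eta>) \<longlongrightarrow> (- \<xi>) \<odot> \<xi>) (at \<xi>)"
    by (intro tendsto_intros)
  have zero: "(- \<xi>) \<odot> \<xi> = 0"
    using mul_minus_cancel_left[of \<xi> 0] by simp
  have y0: "(y \<longlongrightarrow> 0) (at \<xi>)"
    using tendsto_fst[OF lim] unfolding y_def zero by simp
  have \<tau>0: "(\<tau> \<longlongrightarrow> 0) (at \<xi>)"
    using tendsto_snd[OF lim] unfolding \<tau>_def zero by simp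
  have partial: "((\<lambda>\<eta>. u (\<xi> \<odot> (truncate J (y \<eta>), 0))) \<longlongrightarrow> u \<xi>) (at \<xi>)" if "finite J" for J
    using that
  proof (induction J rule: finite_induct)
    case empty
    then show ?case by (simp flip: zero_prod_def)
  next
    case (insert j J)
    let ?q = "\<lambda>\<eta>. \<xi> \<odot> (truncate J (y \<eta>), 0)"
    let ?b = "\<lambda>\<eta>. y \<eta> $ j *\<^sub>R axis j (1::real)"
    let ?w = "\<lambda>\<eta>. \<omega> (truncate J (y \<eta>)) (?b \<eta>)"
    have "((\<lambda>\<eta>. K * \<bar>y \<eta> $ j\<bar> + L * norm (?w \<eta>)) \<longlongrightarrow>
        K * \<bar>(0::real ^ 'h) $ j\<bar> + L * norm (\<omega> 0 ((0::real ^ 'h) $ j *\<^sub>R axis j 1))) (at \<xi>)"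
      by (intro tendsto_intros form.tendsto tendsto_truncate_0 y0)
    then have bound: "((\<lambda>\<eta>. K * \<bar>y \<eta> $ j\<bar> + L * norm (?w \<eta>)) \<longlongrightarrow> 0) (at \<xi>)"
      by (simp add: form.zero_left)
    have "\<bar>u (\<xi> \<odot> (truncate (insert j J) (y \<eta>), 0)) - u (?q \<eta>)\<bar>
        \<le> K * \<bar>y \<eta> $ j\<bar> + L * norm (?w \<eta>)" for \<eta>
      using hor[of "?q \<eta>" "y \<eta> $ j" j] ver[of "?q \<eta> \<odot> (?b \<eta>, 0)" "- ?w \<eta>"]
      unfolding truncate_insert[OF insert(2)] mul_horizontal_add by simp
    then have "((\<lambda>\<eta>. u (\<xi> \<odot> (truncate (insert j J) (y \<eta>), 0)) - u (?q \<eta>)) \<longlongrightarrow> 0) (at \<xi>)"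
      by (intro Lim_null_comparison[OF _ bound]) auto
    from tendsto_add[OF this insert.IH] show ?case by simp
  qed
  have last: "\<bar>u \<eta> - u (\<xi> \<odot> (truncate UNIV (y \<eta>), 0))\<bar> \<le> L * norm (\<tau> \<eta>)" for \<eta>
  proof -
    have "\<eta> = \<xi> \<odot> (y \<eta>, \<tau> \<eta>)" by (simp add: y_def \<tau>_def)
    then show ?thesis
      using ver[of "\<xi> \<odot> (y \<eta>, 0)" "\<tau> \<eta>"] mul_split[of \<xi> "y \<eta>" "\<tau> \<eta>"] by simp
  qed
  have "((\<lambda>\<eta>. u \<eta> - u (\<xi> \<odot> (truncate UNIV (y \<eta>), 0))) \<longlongrightarrow> 0) (at \<xi>)"
  proof (rule Lim_null_comparison[OF always_eventually, rotated])
    show "((\<lambda>\<eta>. L * norm (\<tau> \<eta>)) \<longlongrightarrow> 0) (at \<xi>)"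
      using \<tau>0 tendsto_mult_right_zero tendsto_norm_zero by blast
  qed (use last in simp)
  from tendsto_add[OF this partial[OF finite, of UNIV]]
  show "(u \<longlongrightarrow> u \<xi>) (at \<xi> within UNIV)" by simp
qed

text \<open>
  The fields do not commute, so existence of the derivatives along the basis fields does not give the
  derivative along a combination by the usual argument in coordinates. Adding the coordinate \<open>j\<close> to
  a horizontal step changes the end point by a step along \<open>X\<^sub>j\<close>, which the mean value theorem
  controls, and by the vertical element \<open>-s\<^sup>2 w\<close>. The latter changes \<open>u\<close> by
  \<open>O(\<bar>s\<bar>\<^bsup>2\<beta>\<^esup>)\<close>, which is \<open>o(s)\<close> precisely for \<open>\<beta> > 1/2\<close>.
\<close>

lemma lie_diff_horizontal:
  assumes diff: "\<And>j. lie_diff u (axis j 1, 0) (u' j)"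
    and cont: "\<And>j. continuous_on UNIV (u' j)"
    and ver: "\<And>\<xi> \<tau>. \<bar>u (\<xi> \<odot> (0, \<tau>)) - u \<xi>\<bar> \<le> K * norm \<tau> powr \<beta>"
    and \<beta>: "1 / 2 < \<beta>"
  shows "lie_diff u (y, 0) (\<lambda>\<xi>. \<Sum>j\<in>UNIV. y $ j * u' j \<xi>)"
  unfolding lie_diff_def
proof
  fix \<xi> :: "('h, 'n) hpoint"
  have "((\<lambda>s. (u (\<xi> \<odot> (s *\<^sub>R truncate J y, 0)) - u \<xi>) / s) \<longlongrightarrow> (\<Sum>j\<in>J. y $ j * u' j \<xi>)) (at 0)"
    if "finite J" for J
    using that
  proof (induction J rule: finite_induct)
    case empty
    then show ?case by (simp flip: zero_prod_def)
  next
    case (insert j J)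
    define a where "a = truncate J y"
    define b where "b = y $ j *\<^sub>R (axis j 1 :: real ^ 'h)"
    define w where "w = \<omega> a b"
    define q where "q s = \<xi> \<odot> (s *\<^sub>R a, 0)" for s :: real
    define r where "r s = q s \<odot> (s *\<^sub>R b, 0)" for s :: real
    have "\<exists>\<theta>. 0 < \<theta> \<and> \<theta> < 1 \<and> u (r s) = u (q s) + s * y $ j * u' j (q s \<odot> (\<theta> *\<^sub>R s *\<^sub>R b, 0))" for s
    proof (rule lie_mean_value[OF lie_diff_scale[OF diff[of j], of "s * y $ j"], of "q s"])
      fix \<theta> :: real
      assume "0 < \<theta>" "\<theta> < 1"
        "u (q s \<odot> (s * y $ j) *\<^sub>R (axis j 1, 0)) =
          u (q s) + s * y $ j * u' j (q s \<odot> \<theta> *\<^sub>R (s * y $ j) *\<^sub>R (axis j 1, 0))"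
      then show ?thesis
        unfolding r_def b_def by (intro exI[of _ \<theta>]) simp
    qed
    then obtain \<theta> where \<theta>: "\<And>s. 0 < \<theta> s" "\<And>s. \<theta> s < 1"
      "\<And>s. u (r s) = u (q s) + s * y $ j * u' j (q s \<odot> (\<theta> s *\<^sub>R s *\<^sub>R b, 0))"
      by metis
    have "((\<lambda>s. \<theta> s * s) \<longlongrightarrow> 0) (at 0)"
    proof (rule Lim_null_comparison)
      show "\<forall>\<^sub>F s in at 0. norm (\<theta> s * s) \<le> \<bar>s\<bar>"
        using \<theta>(1,2) by (intro always_eventually allI)
          (simp add: abs_mult mult_left_le_one_le less_imp_le)
    qed (intro tendsto_rabs_zero tendsto_ident_at)
    then have "((\<lambda>s. q s \<odot> ((\<theta> s * s) *\<^sub>R b, 0)) \<longlongrightarrow> \<xi> \<odot> (0 *\<^sub>R a, 0) \<odot> (0 *\<^sub>R b, 0)) (at 0)"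
      unfolding q_def by (intro tendsto_intros)
    then have "((\<lambda>s. q s \<odot> (\<theta> s *\<^sub>R s *\<^sub>R b, 0)) \<longlongrightarrow> \<xi>) (at 0)"
      unfolding scaleR_zero_left zero_prod_def[symmetric] mul_0_right scaleR_scaleR .
    then have main: "((\<lambda>s. u' j (q s \<odot> (\<theta> s *\<^sub>R s *\<^sub>R b, 0))) \<longlongrightarrow> u' j \<xi>) (at 0)"
      by (rule isCont_tendsto_compose[rotated])
        (use cont[of j] continuous_on_eq_continuous_at[OF open_UNIV] in blast)
    have "truncate (insert j J) y = a + b"
      unfolding a_def b_def by (rule truncate_insert[OF insert(2)])
    then have eq: "\<xi> \<odot> (s *\<^sub>R truncate (insert j J) y, 0) = r s \<odot> (0, - (s\<^sup>2 *\<^sub>R w))" for s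
      by (simp only: scaleR_add_right mul_horizontal_add r_def q_def w_def form.scaleR_left
          form.scaleR_right power2_eq_square scaleR_scaleR)
    let ?E = "\<lambda>s. (u (\<xi> \<odot> (s *\<^sub>R truncate (insert j J) y, 0)) - u (r s)) / s"
    have "((\<lambda>s. \<bar>s\<bar> powr (2 * \<beta> - 1)) \<longlongrightarrow> \<bar>0\<bar> powr (2 * \<beta> - 1)) (at (0::real))"
      using \<beta> by (intro tendsto_powr' tendsto_intros) auto
    then have "((\<lambda>s. K * norm w powr \<beta> * \<bar>s\<bar> powr (2 * \<beta> - 1)) \<longlongrightarrow> 0) (at 0)"
      using tendsto_mult_right_zero by fastforce
    then have E: "(?E \<longlongrightarrow> 0) (at 0)"
    proof (rule Lim_null_comparison[rotated])
      show "\<forall>\<^sub>F s in at 0. norm (?E s) \<le> K * norm w powr \<beta> * \<bar>s\<bar> powr (2 * \<beta> - 1)"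
        unfolding eventually_at_filter
      proof (intro always_eventually allI impI)
        fix s :: real assume "s \<noteq> 0"
        have "norm (s\<^sup>2 *\<^sub>R w) powr \<beta> = \<bar>s\<bar> powr (2 * \<beta>) * norm w powr \<beta>"
        proof -
          have "norm (s\<^sup>2 *\<^sub>R w) = \<bar>s\<bar> powr 2 * norm w"
            using \<open>s \<noteq> 0\<close> by (simp add: powr_numeral)
          then show ?thesis by (simp only: powr_mult powr_powr)
        qed
        have "\<bar>s\<bar> powr (2 * \<beta>) / \<bar>s\<bar> = \<bar>s\<bar> powr (2 * \<beta> - 1)"
          using powr_diff[of "\<bar>s\<bar>" "2 * \<beta>" 1] by simp
        have "\<bar>u (\<xi> \<odot> (s *\<^sub>R truncate (insert j J) y, 0)) - u (r s)\<bar>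
            \<le> K * norm (s\<^sup>2 *\<^sub>R w) powr \<beta>"
          using ver[of "r s" "- (s\<^sup>2 *\<^sub>R w)"] by (simp only: eq norm_minus_cancel)
        with \<open>norm (s\<^sup>2 *\<^sub>R w) powr \<beta> = _\<close>
        have "norm (?E s) \<le> K * (\<bar>s\<bar> powr (2 * \<beta>) * norm w powr \<beta>) / \<bar>s\<bar>"
          unfolding real_norm_def abs_divide by (intro divide_right_mono) auto
        also have "\<dots> = K * norm w powr \<beta> * (\<bar>s\<bar> powr (2 * \<beta>) / \<bar>s\<bar>)"
          by simp
        also note \<open>\<bar>s\<bar> powr (2 * \<beta>) / \<bar>s\<bar> = \<bar>s\<bar> powr (2 * \<beta> - 1)\<close>
        finally show "norm (?E s) \<le> K * norm w powr \<beta> * \<bar>s\<bar> powr (2 * \<beta> - 1)" .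
      qed
    qed
    have "((\<lambda>s. (u (q s) - u \<xi>) / s + y $ j * u' j (q s \<odot> (\<theta> s *\<^sub>R s *\<^sub>R b, 0)) + ?E s) \<longlongrightarrow>
        (\<Sum>j\<in>J. y $ j * u' j \<xi>) + y $ j * u' j \<xi> + 0) (at 0)"
      using insert.IH unfolding q_def a_def by (intro tendsto_intros main[unfolded q_def a_def] E)
    then have "((\<lambda>s. (u (q s) - u \<xi>) / s + y $ j * u' j (q s \<odot> (\<theta> s *\<^sub>R s *\<^sub>R b, 0)) + ?E s) \<longlongrightarrow>
        (\<Sum>j\<in>insert j J. y $ j * u' j \<xi>)) (at 0)"
      using insert(1,2) by (simp add: add.commute)
    then show ?case
    proof (rule Lim_transform_eventually)
      show "\<forall>\<^sub>F s in at 0. (u (q s) - u \<xi>) / s + y $ j * u' j (q s \<odot> (\<theta> s *\<^sub>R s *\<^sub>R b, 0)) + ?E s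
          = (u (\<xi> \<odot> (s *\<^sub>R truncate (insert j J) y, 0)) - u \<xi>) / s"
        unfolding eventually_at_filter
        by (intro always_eventually allI impI) (simp add: \<theta>(3) field_simps)
    qed
  qed
  from this[OF finite, of UNIV]
  show "((\<lambda>s. u (\<xi> \<odot> s *\<^sub>R (y, 0))) has_real_derivative (\<Sum>j\<in>UNIV. y $ j * u' j \<xi>)) (at 0)"
    by (simp add: DERIV_def zero_prod_def[symmetric])
qed

end

section \<open>Taylor's formula from Hoelder continuous derivatives\<close>

lemma abs_sum_components_le:
  fixes y :: "real ^ 'i::finite"
  assumes "\<And>i. \<bar>c i\<bar> \<le> B"
  shows "\<bar>\<Sum>i\<in>UNIV. y $ i * c i\<bar> \<le> real CARD('i) * norm y * B"
proof -
  have "\<bar>y $ i * c i\<bar> \<le> norm y * B" for i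
    unfolding abs_mult using assms[of i] component_le_norm_cart[of y i]
    by (intro mult_mono) auto
  then have "(\<Sum>i\<in>UNIV. \<bar>y $ i * c i\<bar>) \<le> real CARD('i) * (norm y * B)"
    by (intro sum_bounded_above) auto
  with sum_abs[of "\<lambda>i. y $ i * c i" UNIV] show ?thesis
    unfolding mult.assoc by (rule order_trans)
qed

lemma sum_axis_mult [simp]: "(\<Sum>i\<in>UNIV. axis k (1::real) $ i * c i) = c k"
  by (simp add: axis_def if_distrib if_distribR cong: if_cong)

lemma powr_2_add: "0 \<le> (r::real) \<Longrightarrow> r powr (2 + a) = r\<^sup>2 * r powr a"
  by (cases "r = 0") (simp_all add: powr_add powr_numeral)

text \<open>
  Here \<open>g j\<close>, \<open>h i j\<close> and \<open>z k\<close> are the derivatives \<open>X\<^sub>j f\<close>, \<open>X\<^sub>i X\<^sub>j f\<close> and \<open>Z\<^sub>k f\<close>. Only the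
  symmetric part of \<open>h\<close> is assumed to be Hoelder continuous, and continuity of \<open>f\<close> and of \<open>g j\<close> is a
  consequence.
\<close>

locale bounded_holder_derivatives = step_two_group \<omega>
  for \<omega> :: "real ^ 'h::finite \<Rightarrow> real ^ 'h \<Rightarrow> real ^ 'n::finite" +
  fixes f :: "('h, 'n) hpoint \<Rightarrow> real"
    and g :: "'h \<Rightarrow> ('h, 'n) hpoint \<Rightarrow> real"
    and h :: "'h \<Rightarrow> 'h \<Rightarrow> ('h, 'n) hpoint \<Rightarrow> real"
    and z :: "'n \<Rightarrow> ('h, 'n) hpoint \<Rightarrow> real"
    and F C \<alpha> :: real
  assumes exponent: "0 < \<alpha>" "\<alpha> < 1"
    and C_nonneg: "0 \<le> C"
    and bounded: "\<bar>f \<xi>\<bar> \<le> F"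
    and Xf: "lie_diff f (axis j 1, 0) (g j)"
    and XXf: "lie_diff (g j) (axis i 1, 0) (h i j)"
    and Zf: "lie_diff f (0, axis k 1) (z k)"
    and XXf_continuous: "continuous_on UNIV (h i j)"
    and hessian_holder: "\<bar>(h i j (\<xi> \<odot> p) + h j i (\<xi> \<odot> p)) / 2 - (h i j \<xi> + h j i \<xi>) / 2\<bar>
        \<le> C * koranyi p powr \<alpha>"
    and z_holder: "\<bar>z k (\<xi> \<odot> p) - z k \<xi>\<bar> \<le> C * koranyi p powr \<alpha>"
begin

definition "K\<^sub>v = 2 * real CARD('n) * C"

lemma K\<^sub>v_nonneg: "0 \<le> K\<^sub>v"
  using C_nonneg by (simp add: K\<^sub>v_def)

lemma F_nonneg: "0 \<le> F"
  using bounded[of 0] by simp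

lemma double_powr_le: "0 \<le> r \<Longrightarrow> (2 * r) powr \<alpha> \<le> 2 * r powr \<alpha>"
  using exponent powr_mono[of \<alpha> 1 2] by (simp add: powr_mult mult_right_mono)

text \<open>
  Vertical steps commute, so the mean value theorem applies to one coordinate after the other. All
  intermediate points lie within the gauge of \<open>(0, \<tau>)\<close>, that is \<open>2 \<surd>\<bar>\<tau>\<bar>\<close>, of \<open>\<xi>\<close>; this is why
  the exponent \<open>\<alpha>\<close> in the gauge turns into \<open>\<alpha> / 2\<close> in \<open>\<bar>\<tau>\<bar>\<close>.
\<close>

lemma vertical_taylor:
  "\<bar>f (\<xi> \<odot> (0, \<tau>)) - f \<xi> - (\<Sum>k\<in>UNIV. \<tau> $ k * z k \<xi>)\<bar> \<le> K\<^sub>v * sqrt (norm \<tau>) powr (2 + \<alpha>)"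
proof -
  have "\<bar>f (\<xi> \<odot> (0, truncate J \<tau>)) - f \<xi> - (\<Sum>k\<in>J. \<tau> $ k * z k \<xi>)\<bar>
      \<le> (\<Sum>k\<in>J. norm \<tau> * (C * koranyi (0 :: real ^ 'h, \<tau>) powr \<alpha>))" if "finite J" for J
    using that
  proof (induction J rule: finite_induct)
    case empty
    then show ?case by (simp flip: zero_prod_def)
  next
    case (insert k J)
    let ?q = "\<xi> \<odot> (0, truncate J \<tau>)"
    have step: "?q \<odot> \<tau> $ k *\<^sub>R (0, axis k 1) = \<xi> \<odot> (0, truncate (insert k J) \<tau>)"
      unfolding truncate_insert[OF insert(2)] by (simp add: mul_def form.zero_right)
    obtain \<theta> where \<theta>: "0 < \<theta>" "\<theta> < 1" and mv:
      "f (?q \<odot> \<tau> $ k *\<^sub>R (0, axis k 1)) = f ?q + \<tau> $ k * z k (?q \<odot> \<theta> *\<^sub>R \<tau> $ k *\<^sub>R (0, axis k 1))"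
      by (rule lie_mean_value[OF lie_diff_scale[OF Zf[of k], of "\<tau> $ k"], of ?q])
    define p :: "('h, 'n) hpoint" where "p = (0, truncate J \<tau> + (\<theta> * \<tau> $ k) *\<^sub>R axis k 1)"
    \<comment> \<open>The point given by the mean value theorem, as an increment from the fixed base point \<open>\<xi>\<close>.\<close>
    have p: "?q \<odot> \<theta> *\<^sub>R \<tau> $ k *\<^sub>R (0, axis k 1) = \<xi> \<odot> p"
      by (simp add: p_def mul_def form.zero_right)
    have "koranyi p \<le> koranyi (0 :: real ^ 'h, \<tau>)"
    proof (rule koranyi_mono)
      show "norm (snd p) \<le> norm (snd (0 :: real ^ 'h, \<tau>))"
        unfolding p_def snd_conv using \<theta> insert(2)
        by (intro norm_le_componentwise_cart)
          (auto simp: truncate_def axis_def abs_mult mult_left_le_one_le)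
    qed (simp add: p_def)
    then have "koranyi p powr \<alpha> \<le> koranyi (0 :: real ^ 'h, \<tau>) powr \<alpha>"
      using exponent by (intro powr_mono2) auto
    then have "\<bar>z k (\<xi> \<odot> p) - z k \<xi>\<bar> \<le> C * koranyi (0 :: real ^ 'h, \<tau>) powr \<alpha>"
      using z_holder[of k \<xi> p] C_nonneg by (meson mult_left_mono order_trans)
    then have "\<bar>\<tau> $ k * (z k (\<xi> \<odot> p) - z k \<xi>)\<bar> \<le> norm \<tau> * (C * koranyi (0 :: real ^ 'h, \<tau>) powr \<alpha>)"
      unfolding abs_mult using component_le_norm_cart[of \<tau> k] by (intro mult_mono) auto
    moreover have "f (\<xi> \<odot> (0, truncate (insert k J) \<tau>)) = f ?q + \<tau> $ k * z k (\<xi> \<odot> p)"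
      using mv unfolding step p .
    ultimately show ?case
      using insert.IH unfolding sum.insert[OF insert(1,2)] right_diff_distrib by linarith
  qed
  from this[OF finite, of UNIV]
  have "\<bar>f (\<xi> \<odot> (0, \<tau>)) - f \<xi> - (\<Sum>k\<in>UNIV. \<tau> $ k * z k \<xi>)\<bar>
      \<le> real CARD('n) * C * norm \<tau> * (2 * sqrt (norm \<tau>)) powr \<alpha>"
    by (simp add: algebra_simps)
  also have "\<dots> \<le> real CARD('n) * C * norm \<tau> * (2 * sqrt (norm \<tau>) powr \<alpha>)"
    using C_nonneg by (intro mult_left_mono double_powr_le) auto
  also have "\<dots> = K\<^sub>v * sqrt (norm \<tau>) powr (2 + \<alpha>)"
    by (simp add: powr_2_add K\<^sub>v_def)
  finally show ?thesis .
qed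

text \<open>
  A unit step in \<open>vertical_taylor\<close> bounds \<open>z k\<close> by the oscillation of \<open>f\<close>. This settles short
  steps; for long ones boundedness of \<open>f\<close> suffices.
\<close>

lemma f_vertical_lipschitz:
  obtains L where "\<And>\<xi> \<tau>. \<bar>f (\<xi> \<odot> (0, \<tau>)) - f \<xi>\<bar> \<le> L * norm \<tau>"
proof -
  have z_bounded: "\<bar>z k \<xi>\<bar> \<le> 2 * F + K\<^sub>v" for k \<xi>
    using vertical_taylor[of \<xi> "axis k 1"] bounded[of \<xi>] bounded[of "\<xi> \<odot> (0, axis k 1)"]
    by (simp add: norm_axis_1)
  let ?B = "real CARD('n) * (2 * F + K\<^sub>v)"
  have B: "0 \<le> ?B"
    using F_nonneg K\<^sub>v_nonneg by simp
  have "\<bar>f (\<xi> \<odot> (0, \<tau>)) - f \<xi>\<bar> \<le> (?B + K\<^sub>v + 2 * F) * norm \<tau>" for \<xi> \<tau>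
  proof (cases "norm \<tau> \<le> 1")
    case True
    have "sqrt (norm \<tau>) powr \<alpha> \<le> 1"
      using True exponent by (intro powr_le1) auto
    then have "sqrt (norm \<tau>) powr (2 + \<alpha>) \<le> norm \<tau>"
      by (simp add: powr_2_add mult_left_le)
    then have "K\<^sub>v * sqrt (norm \<tau>) powr (2 + \<alpha>) \<le> K\<^sub>v * norm \<tau>"
      by (intro mult_left_mono K\<^sub>v_nonneg)
    moreover have "\<bar>\<Sum>k\<in>UNIV. \<tau> $ k * z k \<xi>\<bar> \<le> ?B * norm \<tau>"
      using abs_sum_components_le[of "\<lambda>k. z k \<xi>", OF z_bounded, of \<tau>] by (simp add: mult_ac)
    moreover have "0 \<le> 2 * F * norm \<tau>"
      using F_nonneg by simp
    ultimately show ?thesis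
      using vertical_taylor[of \<xi> \<tau>] unfolding distrib_right by linarith
  next
    case False
    have "\<bar>f (\<xi> \<odot> (0, \<tau>)) - f \<xi>\<bar> \<le> 2 * F"
      using bounded[of \<xi>] bounded[of "\<xi> \<odot> (0, \<tau>)"] by linarith
    also have "\<dots> \<le> 2 * F * norm \<tau>"
      using False F_nonneg mult_left_mono[of 1 "norm \<tau>" "2 * F"] by simp
    also have "\<dots> \<le> (?B + K\<^sub>v + 2 * F) * norm \<tau>"
      using B K\<^sub>v_nonneg by (intro mult_right_mono) auto
    finally show ?thesis .
  qed
  then show thesis by (rule that)
qed

lemma axis_taylor:
  "\<bar>f (\<xi> \<odot> (s *\<^sub>R axis j 1, 0)) - f \<xi> - s * g j \<xi> - s\<^sup>2 / 2 * h j j \<xi>\<bar>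
    \<le> C / 2 * (s\<^sup>2 * \<bar>s\<bar> powr \<alpha>)"
proof -
  obtain \<theta> where \<theta>: "0 < \<theta>" "\<theta> < 1" and t:
    "f (\<xi> \<odot> s *\<^sub>R (axis j 1, 0)) =
      f \<xi> + s * g j \<xi> + s * (s * h j j (\<xi> \<odot> \<theta> *\<^sub>R s *\<^sub>R (axis j 1, 0))) / 2"
    by (rule lie_taylor[OF lie_diff_scale[OF Xf[of j], of s], of "\<lambda>\<xi>. s * (s * h j j \<xi>)" \<xi>])
      (use lie_diff_scale[OF XXf[of j j], of s] in
        \<open>auto simp: lie_diff_def intro!: derivative_eq_intros\<close>)
  let ?p = "(\<theta> *\<^sub>R s *\<^sub>R axis j 1, 0) :: ('h, 'n) hpoint"
  have "koranyi ?p \<le> \<bar>s\<bar>"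
    using \<theta> by (simp add: norm_axis_1 abs_mult mult_left_le_one_le)
  then have "C * koranyi ?p powr \<alpha> \<le> C * \<bar>s\<bar> powr \<alpha>"
    using exponent C_nonneg by (intro mult_left_mono powr_mono2) auto
  with hessian_holder[of j j \<xi> ?p] have "\<bar>h j j (\<xi> \<odot> ?p) - h j j \<xi>\<bar> \<le> C * \<bar>s\<bar> powr \<alpha>"
    by simp
  then have "\<bar>s\<^sup>2 / 2 * (h j j (\<xi> \<odot> ?p) - h j j \<xi>)\<bar> \<le> s\<^sup>2 / 2 * (C * \<bar>s\<bar> powr \<alpha>)"
    unfolding abs_mult by (simp add: mult_left_mono)
  with t show ?thesis
    by (simp add: algebra_simps power2_eq_square)
qed

text \<open>
  Steps of length \<open>1\<close> in both directions along \<open>X\<^sub>j\<close>: the sum of the two expansions isolates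
  \<open>h j j\<close>, their difference isolates \<open>g j\<close>.
\<close>

lemma derivatives_bounded:
  obtains G where "0 \<le> G" "\<And>j \<xi>. \<bar>g j \<xi>\<bar> \<le> G" "\<And>j \<xi>. \<bar>h j j \<xi>\<bar> \<le> G"
proof
  let ?G = "4 * F + 2 * C"
  show "0 \<le> ?G" using F_nonneg C_nonneg by simp
  fix j \<xi>
  have plus: "\<bar>f (\<xi> \<odot> (axis j 1, 0)) - f \<xi> - g j \<xi> - h j j \<xi> / 2\<bar> \<le> C / 2"
    using axis_taylor[of \<xi> 1 j] by simp
  have minus: "\<bar>f (\<xi> \<odot> (- axis j 1, 0)) - f \<xi> + g j \<xi> - h j j \<xi> / 2\<bar> \<le> C / 2"
    using axis_taylor[of \<xi> "- 1" j] by simp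
  note bounds = bounded[of \<xi>] bounded[of "\<xi> \<odot> (axis j 1, 0)"] bounded[of "\<xi> \<odot> (- axis j 1, 0)"]
  show "\<bar>g j \<xi>\<bar> \<le> ?G" using plus minus bounds C_nonneg unfolding abs_le_iff by linarith
  show "\<bar>h j j \<xi>\<bar> \<le> ?G" using plus minus bounds C_nonneg unfolding abs_le_iff by linarith
qed

lemma f_continuous: "continuous_on UNIV f"
proof -
  obtain G where G: "0 \<le> G" "\<And>j \<xi>. \<bar>g j \<xi>\<bar> \<le> G"
    using derivatives_bounded by metis
  obtain L where L: "\<And>\<xi> \<tau>. \<bar>f (\<xi> \<odot> (0, \<tau>)) - f \<xi>\<bar> \<le> L * norm \<tau>"
    using f_vertical_lipschitz by metis
  show ?thesis
  proof (rule continuous_on_if_frame_lipschitz[OF _ L])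
    fix \<xi> j s
    obtain \<theta> where "f (\<xi> \<odot> s *\<^sub>R (axis j 1, 0)) = f \<xi> + s * g j (\<xi> \<odot> \<theta> *\<^sub>R s *\<^sub>R (axis j 1, 0))"
      by (rule lie_mean_value[OF lie_diff_scale[OF Xf[of j], of s], of \<xi>])
    then show "\<bar>f (\<xi> \<odot> (s *\<^sub>R axis j 1, 0)) - f \<xi>\<bar> \<le> G * \<bar>s\<bar>"
      using mult_left_mono[OF G(2), of "\<bar>s\<bar>"] by (simp add: abs_mult mult.commute)
  qed
qed

text \<open>
  Since \<open>h j j\<close> is bounded, the difference quotients of the continuous function \<open>f\<close> along \<open>X\<^sub>j\<close>
  converge uniformly to \<open>g j\<close>.
\<close>

lemma g_continuous: "continuous_on UNIV (g j)"
proof -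
  obtain G where G: "0 \<le> G" "\<And>\<xi>. \<bar>h j j \<xi>\<bar> \<le> G"
    using derivatives_bounded by metis
  let ?D = "\<lambda>s \<xi>. (f (\<xi> \<odot> (s *\<^sub>R axis j 1, 0)) - f \<xi>) / s"
  show ?thesis
  proof (rule uniform_limit_theorem[of _ ?D "at_right 0"])
    have "continuous_on UNIV (\<lambda>\<xi>. \<xi> \<odot> q)" for q
      unfolding continuous_on_def by (auto intro!: tendsto_intros)
    then have "continuous_on UNIV (\<lambda>\<xi>. f (\<xi> \<odot> q))" for q
      by (rule continuous_on_compose2[OF f_continuous]) auto
    then have "continuous_on UNIV (?D s)" if "s \<noteq> 0" for s
      using that by (intro continuous_intros f_continuous) auto
    then show "\<forall>\<^sub>F s in at_right 0. continuous_on UNIV (?D s)"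
      unfolding eventually_at_filter by (intro always_eventually) auto
    show "uniform_limit UNIV ?D (g j) (at_right 0)"
    proof (rule uniform_limitI)
      fix e :: real assume "0 < e"
      \<comment> \<open>The error of the difference quotient with step \<open>s \<le> 1\<close> is below \<open>s (G + C + 1)\<close>.\<close>
      define \<delta> where "\<delta> = min 1 (e / (G + C + 1))"
      have "0 < \<delta>" using \<open>0 < e\<close> G(1) C_nonneg by (simp add: \<delta>_def)
      have "dist (?D s \<xi>) (g j \<xi>) < e" if "s \<in> {0<..<\<delta>}" for s \<xi>
      proof -
        have s: "0 < s" "s < 1" "s * (G + C + 1) < e"
          using that G(1) C_nonneg by (auto simp: \<delta>_def field_simps)
        have "s powr \<alpha> \<le> 1" using s exponent by (intro powr_le1) auto
        then have "C / 2 * (s\<^sup>2 * \<bar>s\<bar> powr \<alpha>) \<le> C / 2 * (s\<^sup>2 * 1)"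
          using C_nonneg s by (intro mult_left_mono) auto
        moreover have "\<bar>s\<^sup>2 / 2 * h j j \<xi>\<bar> \<le> s\<^sup>2 / 2 * G"
          unfolding abs_mult using G(2)[of \<xi>] by (simp add: mult_left_mono)
        ultimately have "\<bar>f (\<xi> \<odot> (s *\<^sub>R axis j 1, 0)) - f \<xi> - s * g j \<xi>\<bar> \<le> s\<^sup>2 / 2 * G + C / 2 * (s\<^sup>2 * 1)"
          using axis_taylor[of \<xi> s j] by linarith
        also have "\<dots> \<le> s\<^sup>2 * (G + C + 1)"
          using G(1) C_nonneg mult_left_mono[of "G / 2 + C / 2" "G + C + 1" "s\<^sup>2"]
          by (simp add: algebra_simps)
        also have "\<dots> = s * (s * (G + C + 1))"
          by (simp add: power2_eq_square)
        also have "\<dots> < s * e"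
          using s by (intro mult_strict_left_mono)
        finally have "\<bar>f (\<xi> \<odot> (s *\<^sub>R axis j 1, 0)) - f \<xi> - s * g j \<xi>\<bar> < s * e" .
        moreover have "s * ?D s \<xi> = f (\<xi> \<odot> (s *\<^sub>R axis j 1, 0)) - f \<xi>"
          using s by simp
        ultimately have "\<bar>s * (?D s \<xi> - g j \<xi>)\<bar> < s * e"
          by (simp only: right_diff_distrib)
        then show ?thesis
          using s by (simp add: abs_mult dist_real_def)
      qed
      then show "\<forall>\<^sub>F s in at_right 0. \<forall>\<xi>\<in>UNIV. dist (?D s \<xi>) (g j \<xi>) < e"
        using eventually_at_right_real[OF \<open>0 < \<delta>\<close>] by (auto elim!: eventually_mono)
    qed
  qed (rule trivial_limit_at_right_real)
qed

text \<open>
  Interpolation. With \<open>r = \<surd>\<bar>\<tau>\<bar>\<close>, the expansion of \<open>f\<close> along \<open>X\<^sub>j\<close> expresses \<open>r g j\<close> at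
  \<open>\<xi>\<close> and at \<open>\<xi> \<odot> (0, \<tau>)\<close> by values of \<open>f\<close> at the four corners of a parallelogram with sides
  \<open>r e\<^sub>j\<close> and \<open>\<tau>\<close>, up to \<open>O(r\<^bsup>2+\<alpha>\<^esup>)\<close>. The vertical expansions along two opposite sides have nearly
  the same linear term, so the second difference of \<open>f\<close> is \<open>O(r\<^bsup>2+\<alpha>\<^esup>)\<close> too. Division by \<open>r\<close> leaves
  \<open>r\<^bsup>1+\<alpha>\<^esup> = \<bar>\<tau>\<bar>\<^bsup>(1+\<alpha>)/2\<^esup>\<close>.
\<close>

lemma g_vertical_holder:
  obtains K where "\<And>\<xi> \<tau>. \<bar>g j (\<xi> \<odot> (0, \<tau>)) - g j \<xi>\<bar> \<le> K * norm \<tau> powr ((1 + \<alpha>) / 2)"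
proof -
  let ?K = "2 * C + 2 * K\<^sub>v + real CARD('n) * C"
  have "\<bar>g j (\<xi> \<odot> (0, \<tau>)) - g j \<xi>\<bar> \<le> ?K * norm \<tau> powr ((1 + \<alpha>) / 2)" for \<xi> \<tau>
  proof (cases "\<tau> = 0")
    case True
    then show ?thesis by (simp flip: zero_prod_def)
  next
    case False
    define r where "r = sqrt (norm \<tau>)"
    have r: "0 < r" "norm \<tau> = r\<^sup>2" using False by (simp_all add: r_def)
    let ?e = "(r *\<^sub>R axis j 1, 0) :: ('h, 'n) hpoint" and ?t = "(0, \<tau>) :: ('h, 'n) hpoint"
    let ?S = "\<lambda>\<xi>. \<Sum>k\<in>UNIV. \<tau> $ k * z k \<xi>"
    let ?E = "r\<^sup>2 * r powr \<alpha>"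
    \<comment> \<open>Centrality of \<open>?t\<close> closes the parallelogram.\<close>
    have comm: "\<xi> \<odot> ?t \<odot> ?e = \<xi> \<odot> ?e \<odot> ?t"
      by (simp add: mul_def form.zero_right)
    have T: "\<bar>f (\<zeta> \<odot> ?e) - f \<zeta> - r * g j \<zeta> - r\<^sup>2 / 2 * h j j \<zeta>\<bar> \<le> C / 2 * ?E" for \<zeta>
      using axis_taylor[of \<zeta> r j] r by simp
    have V: "\<bar>f (\<zeta> \<odot> ?t) - f \<zeta> - ?S \<zeta>\<bar> \<le> K\<^sub>v * ?E" for \<zeta>
      using vertical_taylor[of \<zeta> \<tau>] r by (simp add: powr_2_add flip: r_def)
    have "\<bar>h j j (\<xi> \<odot> ?t) - h j j \<xi>\<bar> \<le> C * (2 * r) powr \<alpha>"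
      using hessian_holder[of j j \<xi> ?t] by (simp flip: r_def)
    also have "\<dots> \<le> C * (2 * r powr \<alpha>)"
      using C_nonneg r by (intro mult_left_mono double_powr_le) auto
    finally have "\<bar>r\<^sup>2 / 2 * (h j j (\<xi> \<odot> ?t) - h j j \<xi>)\<bar> \<le> r\<^sup>2 / 2 * (C * (2 * r powr \<alpha>))"
      unfolding abs_mult by (intro mult_mono) auto
    then have H: "\<bar>r\<^sup>2 / 2 * h j j (\<xi> \<odot> ?t) - r\<^sup>2 / 2 * h j j \<xi>\<bar> \<le> C * ?E"
      by (simp add: algebra_simps)
    have "\<bar>z k (\<xi> \<odot> ?e) - z k \<xi>\<bar> \<le> C * r powr \<alpha>" for k
      using z_holder[of k \<xi> ?e] r by (simp add: norm_axis_1)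
    then have "\<bar>\<Sum>k\<in>UNIV. \<tau> $ k * (z k (\<xi> \<odot> ?e) - z k \<xi>)\<bar> \<le> real CARD('n) * r\<^sup>2 * (C * r powr \<alpha>)"
      using abs_sum_components_le[of "\<lambda>k. z k (\<xi> \<odot> ?e) - z k \<xi>" _ \<tau>] r by simp
    then have S: "\<bar>?S (\<xi> \<odot> ?e) - ?S \<xi>\<bar> \<le> real CARD('n) * C * ?E"
      by (simp add: right_diff_distrib sum_subtractf mult_ac)
    have "\<bar>r * (g j (\<xi> \<odot> ?t) - g j \<xi>)\<bar> \<le> ?K * ?E"
      using T[of \<xi>] T[of "\<xi> \<odot> ?t"] V[of \<xi>] V[of "\<xi> \<odot> ?e"] H S
      unfolding comm right_diff_distrib distrib_right by linarith
    then have "r * \<bar>g j (\<xi> \<odot> ?t) - g j \<xi>\<bar> \<le> r * (?K * (r * r powr \<alpha>))"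
      using r by (simp add: abs_mult power2_eq_square mult_ac)
    then have "\<bar>g j (\<xi> \<odot> ?t) - g j \<xi>\<bar> \<le> ?K * (r * r powr \<alpha>)"
      using r by simp
    moreover have "r * r powr \<alpha> = norm \<tau> powr ((1 + \<alpha>) / 2)"
    proof -
      have "norm \<tau> = r powr 2" using r by (simp add: powr_numeral)
      then have "norm \<tau> powr ((1 + \<alpha>) / 2) = r powr (1 + \<alpha>)"
        by (simp only: powr_powr) (simp add: add_divide_distrib)
      then show ?thesis using r by (simp add: powr_add)
    qed
    ultimately show ?thesis by simp
  qed
  then show thesis by (rule that)
qed

text \<open>
  Second order expansion along the line \<open>s \<mapsto> \<xi> \<odot> (s y, 0)\<close>. The second derivative along this
  single line is a quadratic form in \<open>y\<close>, so the coefficients may be symmetrised before the Hoelder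
  condition is used.
\<close>

lemma horizontal_taylor:
  "\<bar>f (\<xi> \<odot> (y, 0)) - f \<xi> - (\<Sum>j\<in>UNIV. y $ j * g j \<xi>)
      - (\<Sum>j\<in>UNIV. y $ j * (\<Sum>i\<in>UNIV. y $ i * ((h i j \<xi> + h j i \<xi>) / 2))) / 2\<bar>
    \<le> (real CARD('h))\<^sup>2 * C * norm y powr (2 + \<alpha>)"
proof -
  obtain L where L: "\<And>\<xi> \<tau>. \<bar>f (\<xi> \<odot> (0, \<tau>)) - f \<xi>\<bar> \<le> L * norm \<tau>"
    using f_vertical_lipschitz by metis
  have f': "lie_diff f (y, 0) (\<lambda>\<xi>. \<Sum>j\<in>UNIV. y $ j * g j \<xi>)"
    by (rule lie_diff_horizontal[where \<beta> = 1 and K = L, OF Xf g_continuous]) (use L in auto)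
  have "lie_diff (g j) (y, 0) (\<lambda>\<xi>. \<Sum>i\<in>UNIV. y $ i * h i j \<xi>)" for j
  proof -
    obtain K where "\<And>\<xi> \<tau>. \<bar>g j (\<xi> \<odot> (0, \<tau>)) - g j \<xi>\<bar> \<le> K * norm \<tau> powr ((1 + \<alpha>) / 2)"
      using g_vertical_holder by metis
    then show ?thesis
      by (rule lie_diff_horizontal[OF XXf XXf_continuous]) (use exponent in auto)
  qed
  then have "lie_diff (\<lambda>\<xi>. \<Sum>j\<in>UNIV. y $ j * g j \<xi>) (y, 0)
      (\<lambda>\<xi>. \<Sum>j\<in>UNIV. y $ j * (\<Sum>i\<in>UNIV. y $ i * h i j \<xi>))"
    unfolding lie_diff_def by (intro allI DERIV_sum DERIV_cmult) blast
  moreover have sym: "(\<Sum>j\<in>UNIV. y $ j * (\<Sum>i\<in>UNIV. y $ i * h i j \<xi>)) =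
      (\<Sum>j\<in>UNIV. y $ j * (\<Sum>i\<in>UNIV. y $ i * ((h i j \<xi> + h j i \<xi>) / 2)))" for \<xi>
  proof -
    have "(\<Sum>j\<in>UNIV. \<Sum>i\<in>UNIV. y $ j * (y $ i * h i j \<xi>)) =
        (\<Sum>j\<in>UNIV. \<Sum>i\<in>UNIV. y $ j * (y $ i * h j i \<xi>))"
      by (subst sum.swap) (simp add: mult.left_commute)
    moreover have "(\<Sum>j\<in>UNIV. \<Sum>i\<in>UNIV. y $ j * (y $ i * ((h i j \<xi> + h j i \<xi>) / 2))) =
        ((\<Sum>j\<in>UNIV. \<Sum>i\<in>UNIV. y $ j * (y $ i * h i j \<xi>)) +
          (\<Sum>j\<in>UNIV. \<Sum>i\<in>UNIV. y $ j * (y $ i * h j i \<xi>))) / 2"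
      unfolding sum.distrib[symmetric] sum_divide_distrib
      by (intro sum.cong refl) (simp add: field_simps)
    ultimately show ?thesis
      unfolding sum_distrib_left by simp
  qed
  ultimately obtain \<theta> where \<theta>: "0 < \<theta>" "\<theta> < 1" and t:
    "f (\<xi> \<odot> (y, 0)) = f \<xi> + (\<Sum>j\<in>UNIV. y $ j * g j \<xi>) +
      (\<Sum>j\<in>UNIV. y $ j * (\<Sum>i\<in>UNIV. y $ i *
        ((h i j (\<xi> \<odot> \<theta> *\<^sub>R (y, 0)) + h j i (\<xi> \<odot> \<theta> *\<^sub>R (y, 0))) / 2))) / 2"
    using lie_taylor[OF f', of "\<lambda>\<xi>. \<Sum>j\<in>UNIV. y $ j * (\<Sum>i\<in>UNIV. y $ i * h i j \<xi>)" \<xi>]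
    unfolding sym by blast
  define H where "H i j \<zeta> = (h i j \<zeta> + h j i \<zeta>) / 2" for i j \<zeta>
  let ?p = "\<theta> *\<^sub>R (y, 0) :: ('h, 'n) hpoint"
  have "koranyi ?p \<le> norm y"
    using \<theta> by (simp add: mult_left_le_one_le)
  then have "C * koranyi ?p powr \<alpha> \<le> C * norm y powr \<alpha>"
    using exponent C_nonneg by (intro mult_left_mono powr_mono2) auto
  then have "\<bar>H i j (\<xi> \<odot> ?p) - H i j \<xi>\<bar> \<le> C * norm y powr \<alpha>" for i j
    unfolding H_def using hessian_holder[of i j \<xi> ?p] by linarith
  then have "\<bar>\<Sum>j\<in>UNIV. y $ j * (\<Sum>i\<in>UNIV. y $ i * (H i j (\<xi> \<odot> ?p) - H i j \<xi>))\<bar>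
      \<le> real CARD('h) * norm y * (real CARD('h) * norm y * (C * norm y powr \<alpha>))"
    by (intro abs_sum_components_le)
  also have "\<dots> = (real CARD('h))\<^sup>2 * C * norm y powr (2 + \<alpha>)"
    by (simp add: powr_2_add power2_eq_square)
  finally have bound: "\<bar>(\<Sum>j\<in>UNIV. y $ j * (\<Sum>i\<in>UNIV. y $ i * H i j (\<xi> \<odot> ?p)))
      - (\<Sum>j\<in>UNIV. y $ j * (\<Sum>i\<in>UNIV. y $ i * H i j \<xi>))\<bar>
      \<le> (real CARD('h))\<^sup>2 * C * norm y powr (2 + \<alpha>)"
    by (simp add: right_diff_distrib sum_subtractf)
  show ?thesis
    using bound t unfolding H_def[symmetric] by linarith
qed

lemma taylor:
  obtains K where "0 < K" "\<And>\<xi> y \<tau>.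
    \<bar>f (\<xi> \<odot> (y, \<tau>)) - f \<xi> - (\<Sum>j\<in>UNIV. y $ j * g j \<xi>)
      - (\<Sum>j\<in>UNIV. y $ j * (\<Sum>i\<in>UNIV. y $ i * ((h i j \<xi> + h j i \<xi>) / 2))) / 2
      - (\<Sum>k\<in>UNIV. \<tau> $ k * z k \<xi>)\<bar> \<le> K * koranyi (y, \<tau>) powr (2 + \<alpha>)"
proof -
  let ?K = "(real CARD('h))\<^sup>2 * C + K\<^sub>v + real CARD('n) * C"
  have K: "0 \<le> ?K" using C_nonneg K\<^sub>v_nonneg by simp
  have "\<bar>f (\<xi> \<odot> (y, \<tau>)) - f \<xi> - (\<Sum>j\<in>UNIV. y $ j * g j \<xi>)
      - (\<Sum>j\<in>UNIV. y $ j * (\<Sum>i\<in>UNIV. y $ i * ((h i j \<xi> + h j i \<xi>) / 2))) / 2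
      - (\<Sum>k\<in>UNIV. \<tau> $ k * z k \<xi>)\<bar> \<le> (?K + 1) * koranyi (y, \<tau>) powr (2 + \<alpha>)" for \<xi> y \<tau>
  proof -
    define r where "r = koranyi (y, \<tau>)"
    let ?S = "\<lambda>\<xi>. \<Sum>k\<in>UNIV. \<tau> $ k * z k \<xi>"
    let ?q = "\<xi> \<odot> (y, 0)"
    have r: "0 \<le> r" "norm y \<le> r" "norm \<tau> \<le> r\<^sup>2"
      using norm_fst_le_koranyi[of "(y, \<tau>)"] norm_snd_le_koranyi[of "(y, \<tau>)"] by (simp_all add: r_def)
    have "sqrt (norm \<tau>) \<le> r"
      using r real_le_lsqrt by blast
    then have "K\<^sub>v * sqrt (norm \<tau>) powr (2 + \<alpha>) \<le> K\<^sub>v * r powr (2 + \<alpha>)"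
      using exponent K\<^sub>v_nonneg by (intro mult_left_mono powr_mono2) auto
    with vertical_taylor[of ?q \<tau>]
    have V: "\<bar>f (\<xi> \<odot> (y, \<tau>)) - f ?q - ?S ?q\<bar> \<le> K\<^sub>v * r powr (2 + \<alpha>)"
      unfolding mul_split[of \<xi> y \<tau>] by linarith
    have "C * norm y powr \<alpha> \<le> C * r powr \<alpha>"
      using r exponent C_nonneg by (intro mult_left_mono powr_mono2) auto
    then have "\<bar>z k ?q - z k \<xi>\<bar> \<le> C * r powr \<alpha>" for k
      using z_holder[of k \<xi> "(y, 0)"] by simp
    then have "\<bar>\<Sum>k\<in>UNIV. \<tau> $ k * (z k ?q - z k \<xi>)\<bar> \<le> real CARD('n) * norm \<tau> * (C * r powr \<alpha>)"
      by (rule abs_sum_components_le)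
    also have "\<dots> \<le> real CARD('n) * r\<^sup>2 * (C * r powr \<alpha>)"
      using r C_nonneg by (intro mult_right_mono mult_left_mono) auto
    finally have S: "\<bar>?S ?q - ?S \<xi>\<bar> \<le> real CARD('n) * C * r powr (2 + \<alpha>)"
      using r by (simp add: right_diff_distrib sum_subtractf powr_2_add mult_ac)
    have "(real CARD('h))\<^sup>2 * C * norm y powr (2 + \<alpha>) \<le> (real CARD('h))\<^sup>2 * C * r powr (2 + \<alpha>)"
      using r exponent C_nonneg by (intro mult_left_mono powr_mono2) auto
    with horizontal_taylor[of \<xi> y] V S show ?thesis
      unfolding r_def[symmetric] distrib_right using powr_ge_zero[of r "2 + \<alpha>"] by linarith
  qed
  with K show thesis by (intro that[of "?K + 1"]) auto
qed

end

section \<open>Differentiability from polynomial approximation\<close>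

text \<open>
  The remainder \<open>\<bar>s\<bar>\<^bsup>1+\<beta>\<^esup>\<close> is written as a product so that division by \<open>s\<close> needs no calculation
  with exponents.
\<close>

lemma has_real_derivative_if_remainder:
  fixes \<phi> :: "real \<Rightarrow> real"
  assumes "\<And>s. \<bar>s\<bar> \<le> 1 \<Longrightarrow> \<bar>\<phi> s - \<phi> 0 - s * c\<bar> \<le> K * (\<bar>s\<bar> * \<bar>s\<bar> powr \<beta>)" and "0 < \<beta>"
  shows "(\<phi> has_real_derivative c) (at 0)"
proof -
  have "((\<lambda>s. \<bar>s\<bar> powr \<beta>) \<longlongrightarrow> \<bar>0\<bar> powr \<beta>) (at (0::real))"
    using assms(2) by (intro tendsto_powr' tendsto_intros) auto
  then have lim: "((\<lambda>s. K * \<bar>s\<bar> powr \<beta>) \<longlongrightarrow> 0) (at 0)"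
    using tendsto_mult_right_zero by fastforce
  have "\<forall>\<^sub>F s in at (0::real). s \<in> {-1<..<1} \<and> s \<noteq> 0"
    by (intro eventually_conj eventually_at_in_open' eventually_neq_at_within)
      auto
  then have "\<forall>\<^sub>F s in at 0. norm ((\<phi> s - \<phi> 0) / s - c) \<le> K * \<bar>s\<bar> powr \<beta>"
  proof (rule eventually_mono)
    fix s :: real assume s: "s \<in> {-1<..<1} \<and> s \<noteq> 0"
    then have "\<bar>s\<bar> \<le> 1" by auto
    from assms(1)[OF this]
    have "\<bar>\<phi> s - \<phi> 0 - s * c\<bar> \<le> \<bar>s\<bar> * (K * \<bar>s\<bar> powr \<beta>)"
      by (simp add: mult_ac)
    moreover have "\<phi> s - \<phi> 0 - s * c = s * ((\<phi> s - \<phi> 0) / s - c)"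
      using s by (simp add: field_simps)
    ultimately have "\<bar>s\<bar> * \<bar>(\<phi> s - \<phi> 0) / s - c\<bar> \<le> \<bar>s\<bar> * (K * \<bar>s\<bar> powr \<beta>)"
      by (metis abs_mult)
    then show "norm ((\<phi> s - \<phi> 0) / s - c) \<le> K * \<bar>s\<bar> powr \<beta>"
      using s by simp
  qed
  then have "((\<lambda>s. (\<phi> s - \<phi> 0) / s - c) \<longlongrightarrow> 0) (at 0)"
    by (rule Lim_null_comparison[OF _ lim])
  then show ?thesis
    by (simp add: DERIV_def LIM_zero_iff)
qed

lemma inner_symmetric_matrix:
  fixes M :: "real ^ 'i ^ 'i::finite"
  assumes "transpose M = M"
  shows "x \<bullet> (M *v y) = y \<bullet> (M *v x)"
  by (metis assms dot_lmul_matrix inner_commute transpose_matrix_vector)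

lemma polarization:
  fixes N :: "real ^ 'i ^ 'i::finite" and r :: real
  assumes "N $ j $ i = N $ i $ j"
  defines "x \<equiv> r *\<^sub>R (axis i 1 + axis j 1)" and "y \<equiv> r *\<^sub>R (axis i 1 - axis j 1)"
  shows "x \<bullet> (N *v x) - y \<bullet> (N *v y) = 4 * (r\<^sup>2 * N $ i $ j)"
proof -
  have "axis k 1 \<bullet> (N *v axis l 1) = N $ k $ l" for k l
    by (simp add: inner_axis' matrix_vector_mult_basis column_def)
  then show ?thesis
    unfolding x_def y_def using assms(1)
    by (simp add: matrix_vector_mult_scaleR matrix_vector_right_distrib
        matrix_vector_mult_diff_distrib inner_add_left inner_add_right inner_diff_left
        inner_diff_right power2_eq_square algebra_simps)
qed

text \<open>
  A family of second order polynomials approximating \<open>f\<close> at every point. Here \<open>p\<close> is the increment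
  from \<open>\<xi>\<close>, so that \<open>b\<close> and \<open>d\<close> are the derivatives of \<open>f\<close> with their natural sign.
\<close>

locale holder_expansion = step_two_group \<omega>
  for \<omega> :: "real ^ 'h::finite \<Rightarrow> real ^ 'h \<Rightarrow> real ^ 'n::finite" +
  fixes f :: "('h, 'n) hpoint \<Rightarrow> real"
    and b :: "('h, 'n) hpoint \<Rightarrow> real ^ 'h"
    and M :: "('h, 'n) hpoint \<Rightarrow> real ^ 'h ^ 'h"
    and d :: "('h, 'n) hpoint \<Rightarrow> real ^ 'n"
    and C \<alpha> :: real
  assumes exponent: "0 < \<alpha>" "\<alpha> < 1"
    and C_nonneg: "0 \<le> C"
    and M_symmetric: "transpose (M \<xi>) = M \<xi>"
    and expansion: "\<bar>f (\<xi> \<odot> p) - f \<xi> - b \<xi> \<bullet> fst p - fst p \<bullet> (M \<xi> *v fst p) - d \<xi> \<bullet> snd p\<bar>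
        \<le> C * koranyi p powr (2 + \<alpha>)"
begin

lemma M_commute: "M \<xi> $ i $ j = M \<xi> $ j $ i"
  using M_symmetric[of \<xi>] by (metis transpose_def vec_lambda_beta)

lemma lie_diff_f_horizontal: "lie_diff f (axis j 1, 0) (\<lambda>\<xi>. b \<xi> $ j)"
  unfolding lie_diff_def
proof
  fix \<xi>
  let ?m = "axis j 1 \<bullet> (M \<xi> *v axis j 1)"
  show "((\<lambda>s. f (\<xi> \<odot> s *\<^sub>R (axis j 1, 0))) has_real_derivative b \<xi> $ j) (at 0)"
  proof (rule has_real_derivative_if_remainder[OF _ exponent(1)])
    fix s :: real assume s: "\<bar>s\<bar> \<le> 1"
    let ?E = "\<bar>s\<bar> * \<bar>s\<bar> powr \<alpha>"
    have "\<bar>s\<bar> \<le> \<bar>s\<bar> powr \<alpha>"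
      using s exponent powr_mono'[of \<alpha> 1 "\<bar>s\<bar>"] by simp
    then have "\<bar>s\<bar> * \<bar>s\<bar> \<le> ?E"
      by (intro mult_left_mono) auto
    then have "\<bar>?m\<bar> * (\<bar>s\<bar> * \<bar>s\<bar>) \<le> \<bar>?m\<bar> * ?E"
      by (rule mult_left_mono) auto
    moreover have "C * (\<bar>s\<bar> * ?E) \<le> C * ?E"
      using s C_nonneg by (intro mult_left_mono mult_left_le_one_le) auto
    moreover have "\<bar>f (\<xi> \<odot> s *\<^sub>R (axis j 1, 0)) - f \<xi> - s * b \<xi> $ j - s * (s * ?m)\<bar> \<le> C * (\<bar>s\<bar> * ?E)"
      using expansion[of \<xi> "s *\<^sub>R (axis j 1, 0)"]
      by (simp add: norm_axis_1 powr_2_add inner_axis matrix_vector_mult_scaleR power2_eq_square mult_ac)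
    moreover have "\<bar>s * (s * ?m)\<bar> = \<bar>?m\<bar> * (\<bar>s\<bar> * \<bar>s\<bar>)"
      by (simp only: abs_mult mult_ac)
    ultimately have "\<bar>f (\<xi> \<odot> s *\<^sub>R (axis j 1, 0)) - f \<xi> - s * b \<xi> $ j\<bar> \<le> (\<bar>?m\<bar> + C) * ?E"
      unfolding distrib_right by linarith
    then show "\<bar>f (\<xi> \<odot> s *\<^sub>R (axis j 1, 0)) - f (\<xi> \<odot> 0 *\<^sub>R (axis j 1, 0)) - s * b \<xi> $ j\<bar>
        \<le> (\<bar>?m\<bar> + C) * ?E"
      by (simp flip: zero_prod_def)
  qed
qed

lemma lie_diff_f_vertical: "lie_diff f (0, axis k 1) (\<lambda>\<xi>. d \<xi> $ k)"
  unfolding lie_diff_def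
proof
  fix \<xi>
  show "((\<lambda>s. f (\<xi> \<odot> s *\<^sub>R (0, axis k 1))) has_real_derivative d \<xi> $ k) (at 0)"
  proof (rule has_real_derivative_if_remainder)
    fix s :: real assume s: "\<bar>s\<bar> \<le> 1"
    have "(2 * sqrt \<bar>s\<bar>) powr (2 + \<alpha>) = 2 powr (2 + \<alpha>) * (\<bar>s\<bar> * \<bar>s\<bar> powr (\<alpha> / 2))"
    proof -
      have "sqrt \<bar>s\<bar> powr (2 + \<alpha>) = \<bar>s\<bar> powr (1 + \<alpha> / 2)"
        by (simp add: powr_half_sqrt[symmetric] powr_powr add_divide_distrib)
      also have "\<dots> = \<bar>s\<bar> * \<bar>s\<bar> powr (\<alpha> / 2)"
        by (cases "s = 0") (simp_all add: powr_add)
      finally show ?thesis by (simp only: powr_mult)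
    qed
    then show "\<bar>f (\<xi> \<odot> s *\<^sub>R (0, axis k 1)) - f (\<xi> \<odot> 0 *\<^sub>R (0, axis k 1)) - s * d \<xi> $ k\<bar>
        \<le> (C * 2 powr (2 + \<alpha>)) * (\<bar>s\<bar> * \<bar>s\<bar> powr (\<alpha> / 2))"
      using expansion[of \<xi> "s *\<^sub>R (0, axis k 1)"]
      by (simp add: norm_axis_1 inner_axis mult_ac flip: zero_prod_def)
  qed (use exponent in simp)
qed

text \<open>
  The point \<open>\<xi> \<odot> p \<odot> q = \<xi> \<odot> (p \<odot> q)\<close> is expanded from \<open>\<xi> \<odot> p\<close> with increment \<open>q\<close>
  and from \<open>\<xi>\<close> with increment \<open>p \<odot> q\<close>; the expansion at \<open>\<xi>\<close> with increment \<open>p\<close> removes the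
  terms without \<open>q\<close>. The term \<open>d \<xi> \<bullet> \<omega> (fst p) (fst q)\<close> comes from the noncommutative product;
  it is linear in \<open>q\<close> and therefore belongs to the first order part.
\<close>

lemma polynomial_increment:
  obtains K where "0 \<le> K" "\<And>\<xi> p q. koranyi q \<le> 2 * koranyi p \<Longrightarrow>
    \<bar>(b (\<xi> \<odot> p) - b \<xi> - 2 *\<^sub>R (M \<xi> *v fst p)) \<bullet> fst q - d \<xi> \<bullet> \<omega> (fst p) (fst q)
      + fst q \<bullet> ((M (\<xi> \<odot> p) - M \<xi>) *v fst q) + (d (\<xi> \<odot> p) - d \<xi>) \<bullet> snd q\<bar>
    \<le> K * koranyi p powr (2 + \<alpha>)"
proof -
  obtain \<Omega> where \<Omega>: "0 < \<Omega>" "\<And>x y. norm (\<omega> x y) \<le> norm x * norm y * \<Omega>"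
    using form.pos_bounded by blast
  \<comment> \<open>Both components of \<open>p \<odot> q\<close> fit the scale \<open>(3 + \<Omega>) r\<close>: \<open>r + 2 r = 3 r\<close> horizontally, and
    \<open>r\<^sup>2 + 4 r\<^sup>2 + 2 \<Omega> r\<^sup>2 \<le> ((3 + \<Omega>) r)\<^sup>2\<close> vertically.\<close>
  define c where "c = 3 * (3 + \<Omega>)"
  let ?K = "3 * C * c powr (2 + \<alpha>)"
  have "\<bar>(b (\<xi> \<odot> p) - b \<xi> - 2 *\<^sub>R (M \<xi> *v fst p)) \<bullet> fst q - d \<xi> \<bullet> \<omega> (fst p) (fst q)
      + fst q \<bullet> ((M (\<xi> \<odot> p) - M \<xi>) *v fst q) + (d (\<xi> \<odot> p) - d \<xi>) \<bullet> snd q\<bar>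
    \<le> ?K * koranyi p powr (2 + \<alpha>)" if q: "koranyi q \<le> 2 * koranyi p" for \<xi> p q
  proof -
    define r where "r = koranyi p"
    have r: "0 \<le> r" by (simp add: r_def)
    have p_fst: "norm (fst p) \<le> r" and p_snd: "norm (snd p) \<le> r\<^sup>2"
      using norm_fst_le_koranyi[of p] norm_snd_le_koranyi[of p] by (simp_all add: r_def)
    have q_fst: "norm (fst q) \<le> 2 * r"
      using norm_fst_le_koranyi[of q] q by (simp add: r_def)
    have "(koranyi q)\<^sup>2 \<le> (2 * r)\<^sup>2"
      using q by (intro power_mono) (auto simp: r_def)
    then have q_snd: "norm (snd q) \<le> 4 * r\<^sup>2"
      using norm_snd_le_koranyi[of q] by (simp add: power_mult_distrib)
    have "norm (fst p) * norm (fst q) \<le> r * (2 * r)"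
      using p_fst q_fst r by (intro mult_mono) auto
    then have "norm (fst p) * norm (fst q) * \<Omega> \<le> r * (2 * r) * \<Omega>"
      using \<Omega>(1) by (intro mult_right_mono) auto
    then have \<omega>: "norm (\<omega> (fst p) (fst q)) \<le> 2 * \<Omega> * r\<^sup>2"
      using \<Omega>(2)[of "fst p" "fst q"] by (simp add: power2_eq_square mult_ac)
    have "koranyi (p \<odot> q) \<le> 3 * (3 + \<Omega>) * r"
    proof (rule koranyi_le)
      have "norm (fst p + fst q) \<le> 3 * r"
        using p_fst q_fst norm_triangle_ineq[of "fst p" "fst q"] by linarith
      also have "\<dots> \<le> (3 + \<Omega>) * r"
        using \<Omega>(1) r by (intro mult_right_mono) auto
      finally show "norm (fst (p \<odot> q)) \<le> (3 + \<Omega>) * r"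
        by (simp add: mul_def)
      have "norm (snd (p \<odot> q)) \<le> norm (snd p) + norm (snd q) + norm (\<omega> (fst p) (fst q))"
        unfolding mul_def snd_conv by norm
      also have "\<dots> \<le> (5 + 2 * \<Omega>) * r\<^sup>2"
        using p_snd q_snd \<omega> by (simp add: distrib_right)
      also have "\<dots> \<le> (3 + \<Omega>)\<^sup>2 * r\<^sup>2"
        using \<Omega>(1) by (intro mult_right_mono) (auto simp: power2_eq_square algebra_simps)
      finally show "norm (snd (p \<odot> q)) \<le> ((3 + \<Omega>) * r)\<^sup>2"
        by (simp add: power_mult_distrib)
    qed (use \<Omega>(1) r in auto)
    then have pq: "koranyi (p \<odot> q) \<le> c * r" by (simp add: c_def)
    have "2 * r \<le> c * r" "r \<le> c * r"
      using \<Omega>(1) r mult_right_mono[of 2 c r] mult_right_mono[of 1 c r] by (auto simp: c_def)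
    then have le: "koranyi q \<le> c * r" "koranyi p \<le> c * r"
      using q by (auto simp: r_def)
    have remainder: "C * koranyi s powr (2 + \<alpha>) \<le> C * (c powr (2 + \<alpha>) * r powr (2 + \<alpha>))"
      if "koranyi s \<le> c * r" for s
      unfolding powr_mult[symmetric] using that C_nonneg exponent
      by (intro mult_left_mono powr_mono2) auto
    have "f (\<xi> \<odot> p \<odot> q) = f (\<xi> \<odot> (p \<odot> q))"
      by (simp add: mul_assoc)
    moreover have "fst (p \<odot> q) \<bullet> (M \<xi> *v fst (p \<odot> q)) =
        fst p \<bullet> (M \<xi> *v fst p) + 2 * ((M \<xi> *v fst p) \<bullet> fst q) + fst q \<bullet> (M \<xi> *v fst q)"
      using inner_symmetric_matrix[OF M_symmetric, of "fst p" \<xi> "fst q"]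
      by (simp add: mul_def matrix_vector_right_distrib inner_add_left inner_add_right inner_commute)
    ultimately show ?thesis
      using expansion[of "\<xi> \<odot> p" q] expansion[of \<xi> "p \<odot> q"] expansion[of \<xi> p]
        remainder[OF pq] remainder[OF le(1)] remainder[OF le(2)]
      by (simp add: mul_def[of p q] inner_add_right inner_diff_left inner_diff_right
          matrix_vector_mult_diff_rdistrib flip: r_def)
  qed
  moreover have "0 \<le> ?K" using C_nonneg by simp
  ultimately show thesis using that by blast
qed

text \<open>
  The comparison is tested with increments \<open>q\<close> of gauge at most \<open>2 r\<close>. A vertical \<open>q\<close> isolates \<open>d\<close>.
  For a horizontal \<open>q = (x, 0)\<close> the linear part is odd and the quadratic part even in \<open>x\<close>, so
  the tests with \<open>x\<close> and \<open>-x\<close> bound both separately; polarization then gives the entries of \<open>M\<close>.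
\<close>

lemma coefficients_holder:
  obtains K where "0 \<le> K"
    "\<And>\<xi> p k. \<bar>d (\<xi> \<odot> p) $ k - d \<xi> $ k\<bar> \<le> K * koranyi p powr \<alpha>"
    "\<And>\<xi> p i j. \<bar>M (\<xi> \<odot> p) $ i $ j - M \<xi> $ i $ j\<bar> \<le> K * koranyi p powr \<alpha>"
    "\<And>\<xi> p j. \<bar>b (\<xi> \<odot> p) $ j - b \<xi> $ j - 2 * (M \<xi> *v fst p) $ j - d \<xi> \<bullet> \<omega> (fst p) (axis j 1)\<bar>
      \<le> K * (koranyi p * koranyi p powr \<alpha>)"
proof -
  obtain K where K: "0 \<le> K" and increment: "\<And>\<xi> p q. koranyi q \<le> 2 * koranyi p \<Longrightarrow>
    \<bar>(b (\<xi> \<odot> p) - b \<xi> - 2 *\<^sub>R (M \<xi> *v fst p)) \<bullet> fst q - d \<xi> \<bullet> \<omega> (fst p) (fst q)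
      + fst q \<bullet> ((M (\<xi> \<odot> p) - M \<xi>) *v fst q) + (d (\<xi> \<odot> p) - d \<xi>) \<bullet> snd q\<bar>
    \<le> K * koranyi p powr (2 + \<alpha>)"
    using polynomial_increment by metis
  have "\<bar>d (\<xi> \<odot> p) $ k - d \<xi> $ k\<bar> \<le> K * koranyi p powr \<alpha>
      \<and> \<bar>M (\<xi> \<odot> p) $ i $ j - M \<xi> $ i $ j\<bar> \<le> K * koranyi p powr \<alpha>
      \<and> \<bar>b (\<xi> \<odot> p) $ j - b \<xi> $ j - 2 * (M \<xi> *v fst p) $ j - d \<xi> \<bullet> \<omega> (fst p) (axis j 1)\<bar>
        \<le> K * (koranyi p * koranyi p powr \<alpha>)" for \<xi> p i j k
  proof (cases "p = 0")
    case True
    then show ?thesis using K by (simp add: form.zero_left)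
  next
    case False
    define r where "r = koranyi p"
    have r: "0 < r"
      using False koranyi_nonneg[of p] koranyi_eq_0_iff[of p] unfolding r_def by linarith
    have scale: "K * koranyi p powr (2 + \<alpha>) = r\<^sup>2 * (K * r powr \<alpha>)"
      using r by (simp add: powr_2_add flip: r_def)
    let ?N = "M (\<xi> \<odot> p) - M \<xi>"
    let ?l = "\<lambda>x. (b (\<xi> \<odot> p) - b \<xi> - 2 *\<^sub>R (M \<xi> *v fst p)) \<bullet> x - d \<xi> \<bullet> \<omega> (fst p) x"
    \<comment> \<open>The vertical increment \<open>r\<^sup>2 e\<^sub>k\<close> has gauge exactly \<open>2 r\<close>.\<close>
    have "\<bar>r\<^sup>2 * (d (\<xi> \<odot> p) $ k - d \<xi> $ k)\<bar> \<le> r\<^sup>2 * (K * r powr \<alpha>)"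
      using increment[of "(0, r\<^sup>2 *\<^sub>R axis k 1)" p \<xi>] r unfolding scale
      by (simp add: norm_axis_1 inner_axis inner_diff_left form.zero_right right_diff_distrib flip: r_def)
    then have D: "\<bar>d (\<xi> \<odot> p) $ k - d \<xi> $ k\<bar> \<le> K * r powr \<alpha>"
      using r by (simp add: abs_mult)
    have parity: "\<bar>x \<bullet> (?N *v x)\<bar> \<le> r\<^sup>2 * (K * r powr \<alpha>) \<and> \<bar>?l x\<bar> \<le> r\<^sup>2 * (K * r powr \<alpha>)"
      if x: "norm x \<le> 2 * r" for x
    proof -
      have "\<bar>?l x + x \<bullet> (?N *v x)\<bar> \<le> r\<^sup>2 * (K * r powr \<alpha>)"
        using increment[of "(x, 0)" p \<xi>] x unfolding scale by (simp flip: r_def)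
      moreover have "?N *v (- x) = - (?N *v x)"
        using matrix_vector_mult_diff_distrib[of ?N 0 x] by simp
      then have "\<bar>- ?l x + x \<bullet> (?N *v x)\<bar> \<le> r\<^sup>2 * (K * r powr \<alpha>)"
        using increment[of "(- x, 0)" p \<xi>] x unfolding scale
        by (simp add: form.minus_right flip: r_def)
      ultimately show ?thesis by linarith
    qed
    let ?x = "r *\<^sub>R (axis i 1 + axis j 1) :: real ^ 'h" and ?y = "r *\<^sub>R (axis i 1 - axis j 1) :: real ^ 'h"
    have "norm (axis i 1 + axis j 1 :: real ^ 'h) \<le> 2" "norm (axis i 1 - axis j 1 :: real ^ 'h) \<le> 2"
      using norm_triangle_ineq[of "axis i (1::real)" "axis j 1"]
        norm_triangle_ineq4[of "axis i (1::real)" "axis j 1"] by (simp_all add: norm_axis_1)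
    then have "norm ?x \<le> 2 * r" "norm ?y \<le> 2 * r"
      using r by (simp_all add: mult.commute)
    from parity[OF this(1)] parity[OF this(2)]
    have "\<bar>?x \<bullet> (?N *v ?x) - ?y \<bullet> (?N *v ?y)\<bar> \<le> 2 * (r\<^sup>2 * (K * r powr \<alpha>))"
      by linarith
    moreover have "?N $ j $ i = ?N $ i $ j"
      using M_commute by simp
    then have "?x \<bullet> (?N *v ?x) - ?y \<bullet> (?N *v ?y) = 4 * (r\<^sup>2 * ?N $ i $ j)"
      by (rule polarization)
    ultimately have "4 * \<bar>r\<^sup>2 * ?N $ i $ j\<bar> \<le> 2 * (r\<^sup>2 * (K * r powr \<alpha>))"
      by (simp add: abs_mult)
    moreover have "0 \<le> r\<^sup>2 * (K * r powr \<alpha>)"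
      using K by simp
    ultimately have "\<bar>r\<^sup>2 * ?N $ i $ j\<bar> \<le> r\<^sup>2 * (K * r powr \<alpha>)"
      by linarith
    then have M: "\<bar>?N $ i $ j\<bar> \<le> K * r powr \<alpha>"
      using r by (simp add: abs_mult)
    have "\<bar>?l (r *\<^sub>R axis j 1)\<bar> \<le> r\<^sup>2 * (K * r powr \<alpha>)"
      using parity[of "r *\<^sub>R axis j 1"] r by (simp add: norm_axis_1)
    moreover have "?l (r *\<^sub>R axis j 1) = r * ?l (axis j 1)"
      by (simp add: form.scaleR_right right_diff_distrib)
    ultimately have "r * \<bar>?l (axis j 1)\<bar> \<le> r * (K * (r * r powr \<alpha>))"
      using r by (simp add: abs_mult power2_eq_square mult_ac)
    then have "\<bar>?l (axis j 1)\<bar> \<le> K * (r * r powr \<alpha>)"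
      using r by simp
    then show ?thesis
      using D M by (simp add: inner_axis flip: r_def)
  qed
  then show thesis using that[OF K] by blast
qed

text \<open>
  The expansion of the linear coefficient along \<open>X\<^sub>i\<close>. The contribution of \<open>\<omega>\<close> is skew in \<open>i, j\<close> and
  accounts for the commutator of \<open>X\<^sub>i\<close> and \<open>X\<^sub>j\<close>.
\<close>

lemma lie_diff_b:
  "lie_diff (\<lambda>\<xi>. b \<xi> $ j) (axis i 1, 0) (\<lambda>\<xi>. 2 * M \<xi> $ i $ j + d \<xi> \<bullet> \<omega> (axis i 1) (axis j 1))"
  unfolding lie_diff_def
proof
  fix \<xi>
  obtain K where K: "\<And>\<xi> p j.
    \<bar>b (\<xi> \<odot> p) $ j - b \<xi> $ j - 2 * (M \<xi> *v fst p) $ j - d \<xi> \<bullet> \<omega> (fst p) (axis j 1)\<bar>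
      \<le> K * (koranyi p * koranyi p powr \<alpha>)"
    using coefficients_holder by metis
  show "((\<lambda>s. b (\<xi> \<odot> s *\<^sub>R (axis i 1, 0)) $ j) has_real_derivative
      2 * M \<xi> $ i $ j + d \<xi> \<bullet> \<omega> (axis i 1) (axis j 1)) (at 0)"
  proof (rule has_real_derivative_if_remainder[OF _ exponent(1)])
    fix s :: real
    have "(M \<xi> *v (s *\<^sub>R axis i 1)) $ j = s * M \<xi> $ i $ j"
      using M_commute[of \<xi> i j]
      by (simp add: matrix_vector_mult_scaleR matrix_vector_mult_basis column_def)
    then show "\<bar>b (\<xi> \<odot> s *\<^sub>R (axis i 1, 0)) $ j - b (\<xi> \<odot> 0 *\<^sub>R (axis i 1, 0)) $ j
        - s * (2 * M \<xi> $ i $ j + d \<xi> \<bullet> \<omega> (axis i 1) (axis j 1))\<bar> \<le> K * (\<bar>s\<bar> * \<bar>s\<bar> powr \<alpha>)"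
      using K[of \<xi> "s *\<^sub>R (axis i 1, 0)" j]
      by (simp add: norm_axis_1 form.scaleR_left distrib_left diff_diff_eq mult.left_commute
          flip: zero_prod_def)
  qed
qed

lemma d_continuous: "continuous_on UNIV (\<lambda>\<xi>. d \<xi> $ k)"
proof -
  obtain K where "\<And>\<xi> p k. \<bar>d (\<xi> \<odot> p) $ k - d \<xi> $ k\<bar> \<le> K * koranyi p powr \<alpha>"
    using coefficients_holder by metis
  then show ?thesis
    by (intro continuous_on_if_koranyi_holder[OF _ exponent(1)])
qed

lemma M_continuous: "continuous_on UNIV (\<lambda>\<xi>. M \<xi> $ i $ j)"
proof -
  obtain K where "\<And>\<xi> p i j. \<bar>M (\<xi> \<odot> p) $ i $ j - M \<xi> $ i $ j\<bar> \<le> K * koranyi p powr \<alpha>"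
    using coefficients_holder by metis
  then show ?thesis
    by (intro continuous_on_if_koranyi_holder[OF _ exponent(1)])
qed

end

section \<open>The hyperplane as a step two group\<close>

definition restricted_form ::
  "('h::finite, 'n::finite) structure_mats \<Rightarrow> real ^ 'h \<Rightarrow> real ^ 'h \<Rightarrow> real ^ 'n" where
  "restricted_form A x y =
     (\<chi> k. 1 / 2 * (\<Sum>j\<in>UNIV. (\<Sum>i\<in>UNIV. A k $ Some j $ Some i * x $ i) * y $ j))"

lemma sum_UNIV_option: "(\<Sum>i\<in>UNIV. c i) = c None + (\<Sum>j\<in>UNIV. c (Some j))"
  for c :: "'i::finite option \<Rightarrow> real"
  by (simp add: UNIV_option_conv sum.reindex)

lemma step_two_group_restricted_form:
  assumes "htype_matrices A"
  shows "step_two_group (restricted_form A)"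
proof (rule step_two_group.intro)
  have "bilinear (restricted_form A)"
    unfolding bilinear_def linear_iff restricted_form_def
    by (simp add: vec_eq_iff algebra_simps sum.distrib sum_distrib_left)
  then show "bounded_bilinear (restricted_form A)"
    by (simp add: bilinear_conv_bounded_bilinear)
  fix x
  show "restricted_form A x x = 0"
  proof -
    have "(\<Sum>j\<in>UNIV. \<Sum>i\<in>UNIV. A k $ Some j $ Some i * x $ i * x $ j) = 0" for k
    proof -
      let ?S = "\<Sum>j\<in>UNIV. \<Sum>i\<in>UNIV. A k $ Some j $ Some i * x $ i * x $ j"
      have "?S = (\<Sum>j\<in>UNIV. \<Sum>i\<in>UNIV. A k $ Some i $ Some j * x $ j * x $ i)"
        by (rule sum.swap)
      also have "\<dots> = - ?S"
        unfolding sum_negf[symmetric]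
      proof (intro sum.cong refl)
        fix i j
        show "A k $ Some i $ Some j * x $ j * x $ i = - (A k $ Some j $ Some i * x $ i * x $ j)"
          using htype_skew_entry[OF assms, of k "Some i" "Some j"] by simp
      qed
      finally show ?thesis by simp
    qed
    then show ?thesis
      by (simp add: restricted_form_def vec_eq_iff sum_distrib_right)
  qed
qed

locale hyperplane_group =
  fixes A :: "('h::finite, 'n::finite) structure_mats"
  assumes htype: "htype_matrices A"
begin

sublocale step_two_group "restricted_form A"
  by (rule step_two_group_restricted_form[OF htype])

notation mul (infixl "\<odot>" 70)

lemma hat_gLog_embed: "hat (gLog A (embed \<eta>) (embed \<xi>)) = (- \<eta>) \<odot> \<xi>"
  by (simp add: hat_def gLog_def gmult_def ginv_def embed_def mul_def restricted_form_def
      prod_eq_iff vec_eq_iff matrix_vector_mult_def inner_vec_def sum_UNIV_option)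

lemma gnorm_embed: "gnorm (embed p) = koranyi p"
proof -
  have "norm (fst (embed p)) = norm (fst p)"
    by (simp add: embed_def norm_vec_def L2_set_def sum_UNIV_option)
  then show ?thesis
    by (simp add: gnorm_def koranyi_def) (simp add: embed_def)
qed

lemma hdist_eq: "hdist A \<xi> \<eta> = koranyi ((- \<eta>) \<odot> \<xi>)"
  unfolding hdist_def gLog_def[symmetric]
  by (subst embed_hat_gLog[symmetric]) (simp only: hat_gLog_embed gnorm_embed)

lemma hdist_mul [simp]: "hdist A \<xi> (\<xi> \<odot> p) = koranyi p" "hdist A (\<xi> \<odot> p) \<xi> = koranyi p"
  by (simp_all add: hdist_eq)

text \<open>
  The logarithm that enters the polynomial points from \<open>\<xi> \<odot> p\<close> back to \<open>\<xi>\<close>; hence the signs of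
  the terms of odd degree in \<open>p\<close> and of the vertical term.
\<close>

lemma hpoly_mul:
  "hpoly A \<xi> a b M d (\<xi> \<odot> p) = a - b \<bullet> fst p + fst p \<bullet> (M *v fst p) - d \<bullet> snd p"
proof -
  have "M *v (- fst p) = - (M *v fst p)"
    using matrix_vector_mult_diff_distrib[of M 0 "fst p"] by simp
  then show ?thesis
    by (cases p) (simp add: hpoly_def hat_gLog_embed)
qed

text \<open>
  The second component of \<open>hX A j \<xi>\<close> is \<open>\<omega> (fst \<xi>) e\<^sub>j\<close>, the derivative of the group law.
\<close>

lemma line_hX: "\<xi> + s *\<^sub>R hX A j \<xi> = \<xi> \<odot> s *\<^sub>R (axis j 1, 0)"
  by (simp add: hX_def mul_def prod_eq_iff form.scaleR_right)
    (simp add: restricted_form_def vec_eq_iff axis_def if_distrib sum_distrib_right cong: if_cong)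

lemma line_hZ: "\<xi> + s *\<^sub>R hZ k \<xi> = \<xi> \<odot> s *\<^sub>R (0, axis k 1)"
  by (simp add: hZ_def mul_def prod_eq_iff form.zero_right)

lemma lie_diff_iff:
  assumes "\<And>\<xi> s. \<xi> + s *\<^sub>R V \<xi> = \<xi> \<odot> s *\<^sub>R v"
  shows "lie_diff u v u' \<longleftrightarrow> (\<forall>\<xi>. Lie_differentiable V u \<xi>) \<and> u' = Lie_deriv V u"
  unfolding lie_diff_def Lie_differentiable_def Lie_deriv_def assms fun_eq_iff
  using DERIV_imp_deriv field_differentiable_def DERIV_deriv_iff_field_differentiable by metis

lemmas lie_diff_hX_iff = lie_diff_iff[of "hX A j", OF line_hX] for j
lemmas lie_diff_hZ_iff = lie_diff_iff[of "hZ k", OF line_hZ] for k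

lemma Gamma2_alpha_if_C2_alpha:
  assumes "0 < \<alpha>" and "\<alpha> < 1" and "bounded (range f)" and "C2_alpha A \<alpha> f"
  shows "Gamma2_alpha A \<alpha> f"
proof -
  obtain F where F: "\<And>\<xi>. \<bar>f \<xi>\<bar> \<le> F"
    using assms(3) by (auto simp: bounded_iff)
  define g where "g j = Lie_deriv (hX A j) f" for j
  define h where "h i j = Lie_deriv (hX A i) (g j)" for i j
  define z where "z k = Lie_deriv (hZ k) f" for k
  obtain C where C: "0 < C"
    "\<And>i j \<xi> \<eta>. \<bar>hHessian A f \<eta> $ i $ j - hHessian A f \<xi> $ i $ j\<bar> \<le> C * hdist A \<eta> \<xi> powr \<alpha>"
    "\<And>k \<xi> \<eta>. \<bar>z k \<eta> - z k \<xi>\<bar> \<le> C * hdist A \<xi> \<eta> powr \<alpha>"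
    using assms(4) unfolding C2_alpha_def z_def by blast
  have hess: "hHessian A f \<xi> $ i $ j = (h i j \<xi> + h j i \<xi>) / 2" for \<xi> i j
    by (simp add: hHessian_def h_def g_def)
  interpret bounded_holder_derivatives "restricted_form A" f g h z F C \<alpha>
  proof
    show "lie_diff f (axis j 1, 0) (g j)" "lie_diff (g j) (axis i 1, 0) (h i j)"
      "continuous_on UNIV (h i j)" for i j
      using assms(4) unfolding C2_alpha_def lie_diff_hX_iff h_def g_def by blast+
    show "lie_diff f (0, axis k 1) (z k)" for k
      using assms(4) unfolding C2_alpha_def lie_diff_hZ_iff z_def by blast
    show "\<bar>(h i j (\<xi> \<odot> p) + h j i (\<xi> \<odot> p)) / 2 - (h i j \<xi> + h j i \<xi>) / 2\<bar>
        \<le> C * koranyi p powr \<alpha>" for i j \<xi> p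
      using C(2)[where \<eta> = "\<xi> \<odot> p" and \<xi> = \<xi>] unfolding hess by simp
    show "\<bar>z k (\<xi> \<odot> p) - z k \<xi>\<bar> \<le> C * koranyi p powr \<alpha>" for k \<xi> p
      using C(3)[of k "\<xi> \<odot> p" \<xi>] by simp
    show "0 < \<alpha>" "\<alpha> < 1" "0 \<le> C" "\<And>\<xi>. \<bar>f \<xi>\<bar> \<le> F"
      using assms(1,2) F C(1) by simp_all
  qed
  obtain K where K: "0 < K" "\<And>\<xi> y \<tau>.
    \<bar>f (\<xi> \<odot> (y, \<tau>)) - f \<xi> - (\<Sum>j\<in>UNIV. y $ j * g j \<xi>)
      - (\<Sum>j\<in>UNIV. y $ j * (\<Sum>i\<in>UNIV. y $ i * ((h i j \<xi> + h j i \<xi>) / 2))) / 2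
      - (\<Sum>k\<in>UNIV. \<tau> $ k * z k \<xi>)\<bar> \<le> K * koranyi (y, \<tau>) powr (2 + \<alpha>)"
    by (rule taylor) (rule that; blast)
  show ?thesis
    unfolding Gamma2_alpha_def
  proof (rule exI[of _ K], intro conjI allI)
    fix \<xi>
    define b where "b = - (\<chi> j. g j \<xi>)"
    \<comment> \<open>One half from Taylor's formula and one half from symmetrising.\<close>
    define M :: "real ^ 'h ^ 'h" where "M = (\<chi> j i. (h i j \<xi> + h j i \<xi>) / 4)"
    define d where "d = - (\<chi> k. z k \<xi>)"
    have "transpose M = M"
      by (simp add: M_def transpose_def vec_eq_iff add.commute)
    moreover have "\<bar>f \<eta> - hpoly A \<xi> (f \<xi>) b M d \<eta>\<bar> < K * \<rho> powr (2 + \<alpha>)"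
      if "\<eta> \<in> hball A \<rho> \<xi>" for \<rho> \<eta>
    proof -
      define p where "p = (- \<xi>) \<odot> \<eta>"
      have \<eta>: "\<eta> = \<xi> \<odot> p" by (simp add: p_def)
      have "koranyi p < \<rho>" using that by (simp add: hball_def \<eta>)
      then have "K * koranyi p powr (2 + \<alpha>) < K * \<rho> powr (2 + \<alpha>)"
        using K(1) assms(1) by (intro mult_strict_left_mono powr_less_mono2) auto
      moreover have "fst p \<bullet> (M *v fst p) =
          (\<Sum>j\<in>UNIV. fst p $ j * (\<Sum>i\<in>UNIV. fst p $ i * ((h i j \<xi> + h j i \<xi>) / 2))) / 2"
        by (simp add: inner_vec_def matrix_vector_mult_def M_def sum_divide_distrib sum_distrib_left
            mult_ac)
      moreover have "b \<bullet> fst p = - (\<Sum>j\<in>UNIV. fst p $ j * g j \<xi>)"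
        "d \<bullet> snd p = - (\<Sum>k\<in>UNIV. snd p $ k * z k \<xi>)"
        by (simp_all add: b_def d_def inner_vec_def sum_negf mult.commute)
      ultimately show ?thesis
        using K(2)[of \<xi> "fst p" "snd p"] unfolding \<eta> hpoly_mul by (simp add: algebra_simps)
    qed
    ultimately show "\<exists>a b M d. transpose M = M \<and>
        (\<forall>\<rho>>0. \<forall>\<eta>\<in>hball A \<rho> \<xi>. \<bar>f \<eta> - hpoly A \<xi> a b M d \<eta>\<bar> < K * \<rho> powr (2 + \<alpha>))"
      by blast
  qed (rule K(1))
qed

lemma C2_alpha_if_Gamma2_alpha:
  assumes "0 < \<alpha>" and "\<alpha> < 1" and "Gamma2_alpha A \<alpha> f"
  shows "C2_alpha A \<alpha> f"
proof -
  obtain C where C: "0 < C" and "\<forall>\<xi>. \<exists>a b M d. transpose M = M \<and>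
      (\<forall>\<rho>>0. \<forall>\<eta>\<in>hball A \<rho> \<xi>. \<bar>f \<eta> - hpoly A \<xi> a b M d \<eta>\<bar> < C * \<rho> powr (2 + \<alpha>))"
    using assms(3) unfolding Gamma2_alpha_def by blast
  then obtain a b M d where M: "\<And>\<xi>. transpose (M \<xi>) = M \<xi>" and approx:
    "\<And>\<xi> \<rho> \<eta>. 0 < \<rho> \<Longrightarrow> \<eta> \<in> hball A \<rho> \<xi> \<Longrightarrow>
      \<bar>f \<eta> - hpoly A \<xi> (a \<xi>) (b \<xi>) (M \<xi>) (d \<xi>) \<eta>\<bar> < C * \<rho> powr (2 + \<alpha>)"
    by metis
  have bound: "\<bar>f (\<xi> \<odot> p) - (a \<xi> - b \<xi> \<bullet> fst p + fst p \<bullet> (M \<xi> *v fst p) - d \<xi> \<bullet> snd p)\<bar>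
      \<le> C * koranyi p powr (2 + \<alpha>)" (is "?e \<le> _") for \<xi> p
  \<comment> \<open>The open balls only give bounds for radii above \<open>koranyi p\<close>; the bound at the gauge itself,
    in particular \<open>a \<xi> = f \<xi>\<close> for \<open>p = 0\<close>, is the limit of these.\<close>
  proof (rule tendsto_lowerbound)
    show "((\<lambda>\<rho>. C * \<rho> powr (2 + \<alpha>)) \<longlongrightarrow> C * koranyi p powr (2 + \<alpha>)) (at_right (koranyi p))"
      using assms(1)
      by (intro tendsto_mult_left tendsto_powr' tendsto_intros)
        (auto simp: eventually_at_filter intro: always_eventually order_trans[OF koranyi_nonneg])
    show "\<forall>\<^sub>F \<rho> in at_right (koranyi p). ?e \<le> C * \<rho> powr (2 + \<alpha>)"
      unfolding eventually_at_filter
    proof (intro always_eventually allI impI)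
      fix \<rho> assume "\<rho> \<in> {koranyi p<..}"
      then have "0 < \<rho>" "\<xi> \<odot> p \<in> hball A \<rho> \<xi>"
        using koranyi_nonneg[of p] by (auto simp: hball_def simp del: koranyi_nonneg)
      from approx[OF this] show "?e \<le> C * \<rho> powr (2 + \<alpha>)"
        unfolding hpoly_mul by (rule less_imp_le)
    qed
  qed (rule trivial_limit_at_right_real)
  have a: "a \<xi> = f \<xi>" for \<xi>
    using bound[of \<xi> 0] by simp
  interpret holder_expansion "restricted_form A" f "\<lambda>\<xi>. - b \<xi>" M "\<lambda>\<xi>. - d \<xi>" C \<alpha>
  proof
    show "\<bar>f (\<xi> \<odot> p) - f \<xi> - (- b \<xi>) \<bullet> fst p - fst p \<bullet> (M \<xi> *v fst p) - (- d \<xi>) \<bullet> snd p\<bar>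
        \<le> C * koranyi p powr (2 + \<alpha>)" for \<xi> p
      using bound[of \<xi> p] unfolding a by (simp add: algebra_simps)
    show "0 < \<alpha>" "\<alpha> < 1" "0 \<le> C" "\<And>\<xi>. transpose (M \<xi>) = M \<xi>"
      using assms(1,2) C M by simp_all
  qed
  define h where "h i j \<xi> = 2 * M \<xi> $ i $ j + (- d \<xi>) \<bullet> restricted_form A (axis i 1) (axis j 1)" for i j \<xi>
  have Xf: "Lie_differentiable (hX A j) f \<xi>" "Lie_deriv (hX A j) f = (\<lambda>\<xi>. (- b \<xi>) $ j)" for j \<xi>
    using lie_diff_f_horizontal[of j] unfolding lie_diff_hX_iff by metis+
  have XXf: "Lie_differentiable (hX A i) (Lie_deriv (hX A j) f) \<xi>"
    "Lie_deriv (hX A i) (Lie_deriv (hX A j) f) = h i j" for i j \<xi>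
    using lie_diff_b[of j i] unfolding lie_diff_hX_iff Xf(2) h_def by metis+
  have Zf: "Lie_differentiable (hZ k) f \<xi>" "Lie_deriv (hZ k) f = (\<lambda>\<xi>. (- d \<xi>) $ k)" for k \<xi>
    using lie_diff_f_vertical[of k] unfolding lie_diff_hZ_iff by metis+
  have hess: "hHessian A f \<xi> $ i $ j = 2 * M \<xi> $ i $ j" for \<xi> i j
    using skew[of "axis i 1" "axis j 1"] M_commute[of \<xi> i j]
    by (simp add: hHessian_def XXf(2) h_def)
  obtain K where K: "0 \<le> K"
    "\<And>\<xi> p k. \<bar>(- d (\<xi> \<odot> p)) $ k - (- d \<xi>) $ k\<bar> \<le> K * koranyi p powr \<alpha>"
    "\<And>\<xi> p i j. \<bar>M (\<xi> \<odot> p) $ i $ j - M \<xi> $ i $ j\<bar> \<le> K * koranyi p powr \<alpha>"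
    using coefficients_holder by metis
  have h_continuous: "continuous_on UNIV (h i j)" for i j
    unfolding h_def inner_vec_def inner_real_def
    by (intro continuous_on_add continuous_on_mult_left continuous_on_mult_right continuous_on_sum
        M_continuous d_continuous)
  have holder: "\<bar>hHessian A f \<eta> $ i $ j - hHessian A f \<xi> $ i $ j\<bar> \<le> (2 * K + 1) * hdist A \<eta> \<xi> powr \<alpha>"
    "\<bar>Lie_deriv (hZ k) f \<eta> - Lie_deriv (hZ k) f \<xi>\<bar> \<le> (2 * K + 1) * hdist A \<xi> \<eta> powr \<alpha>"
    for i j k \<xi> \<eta>
  proof -
    define p where "p = (- \<xi>) \<odot> \<eta>"
    have \<eta>: "\<eta> = \<xi> \<odot> p" by (simp add: p_def)
    have nonneg: "0 \<le> K * koranyi p powr \<alpha>" "0 \<le> koranyi p powr \<alpha>"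
      using K(1) by simp_all
    show "\<bar>hHessian A f \<eta> $ i $ j - hHessian A f \<xi> $ i $ j\<bar> \<le> (2 * K + 1) * hdist A \<eta> \<xi> powr \<alpha>"
      using K(3)[of \<xi> p i j] nonneg unfolding \<eta> hess hdist_mul distrib_right by linarith
    show "\<bar>Lie_deriv (hZ k) f \<eta> - Lie_deriv (hZ k) f \<xi>\<bar> \<le> (2 * K + 1) * hdist A \<xi> \<eta> powr \<alpha>"
      using K(2)[of \<xi> p k] nonneg unfolding \<eta> Zf(2) hdist_mul distrib_right by linarith
  qed
  have "continuous_on UNIV (Lie_deriv (hZ k) f)" for k
    unfolding Zf(2) by (rule d_continuous)
  moreover have "continuous_on UNIV (Lie_deriv (hX A i) (Lie_deriv (hX A j) f))" for i j
    unfolding XXf(2) by (rule h_continuous)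
  moreover have "0 < 2 * K + 1" using K(1) by simp
  ultimately show ?thesis
    unfolding C2_alpha_def using Xf(1) XXf(1) Zf(1) holder by blast
qed

end

section \<open>The equivalence\<close>

theorem proposition6p11:
  fixes A :: "'n::finite \<Rightarrow> real ^ ('h::finite) option ^ 'h option"
    and f :: "(real ^ 'h) \<times> (real ^ 'n) \<Rightarrow> real"
    and \<alpha> :: real
  assumes "htype_matrices A"
    and "0 < \<alpha>" and "\<alpha> < 1"
    and "bounded (range f)"
  shows "C2_alpha A \<alpha> f \<longleftrightarrow> Gamma2_alpha A \<alpha> f"
proof -
  interpret hyperplane_group A
    by unfold_locales (rule assms(1))
  show ?thesis
    using Gamma2_alpha_if_C2_alpha[OF assms(2-4)] C2_alpha_if_Gamma2_alpha[OF assms(2,3)] by blast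
qed

end
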